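(* Let $d\in\mathbb{N}$ with $d\geq 4$ and let $(c_{n})_{n\in\mathbb{N}}$ be a sequence of positive real numbers with $c_{n}\geq \left(1+\frac{2^{d+5}}{\log n}\right)^{1/d}$ for every $n\geq 2$. For each $n\in\mathbb{N}$ define $F_{n}\colon \binom{\mathbb{Z}^{d}}{n^{d}}\to(0,\infty)$ by $$F_{n}(S)=\min\{\operatorname{Lip}(f)\colon f\colon S\to\{1,\ldots,n\}^{d}\text{ surjective}\}.$$ Consider the probability space $\mathcal{G}_{(c_{n})}=\prod_{n=1}^{\infty}\binom{\{1,\ldots,\lfloor c_{n} n\rfloor\}^{d}}{n^{d}}$ equipped with the product of the uniform probability measures on its (finite) factors. Then a random sequence $(S_{n})\in\mathcal{G}_{(c_{n})}$ satisfies $$\mathbb{P}\left[\limsup_{n\to\infty}F_{n}(S_{n})(\log n)^{-1}<\infty\right]=1.$$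
   Context: $\log$ denotes the logarithm to base $2$. For a set $A$ and $k\in\mathbb{N}$, $\binom{A}{k}$ is the set of all $k$-element subsets of $A$. Lipschitz constants are taken with respect to the Euclidean metric. For a finite set $X$ the uniform probability measure is $\mathbb{P}_X(A)=|A|/|X|$ for $A\subseteq X$; on a countable product of finite sets one takes the product of these uniform measures. *)

theory Defs
  imports "HOL-Probability.Probability"
begin

text \<open>Points of \<Z>^d are represented as functions nat \<Rightarrow> int that vanish at indices \<ge> d.\<close>

definition zvecs :: "nat \<Rightarrow> (nat \<Rightarrow> int) set" where
  "zvecs d = {x. \<forall>i\<ge>d. x i = 0}"

definition grid :: "nat \<Rightarrow> nat \<Rightarrow> (nat \<Rightarrow> int) set" where
  "grid d m = {x \<in> zvecs d. \<forall>i<d. 1 \<le> x i \<and> x i \<le> int m}"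

definition edist :: "nat \<Rightarrow> (nat \<Rightarrow> int) \<Rightarrow> (nat \<Rightarrow> int) \<Rightarrow> real" where
  "edist d x y = sqrt (\<Sum>i<d. (real_of_int (x i - y i))^2)"

definition lip :: "nat \<Rightarrow> (nat \<Rightarrow> int) set \<Rightarrow> ((nat \<Rightarrow> int) \<Rightarrow> (nat \<Rightarrow> int)) \<Rightarrow> real" where
  "lip d S f = Inf {L. L \<ge> 0 \<and> (\<forall>x\<in>S. \<forall>y\<in>S. edist d (f x) (f y) \<le> L * edist d x y)}"

definition Fn :: "nat \<Rightarrow> nat \<Rightarrow> (nat \<Rightarrow> int) set \<Rightarrow> real" where
  "Fn d n S = Inf {lip d S f | f. f ` S = grid d n}"

definition factor_set :: "nat \<Rightarrow> (nat \<Rightarrow> real) \<Rightarrow> nat \<Rightarrow> (nat \<Rightarrow> int) set set" where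
  "factor_set d c n = {S. S \<subseteq> grid d (nat \<lfloor>c n * real n\<rfloor>) \<and> card S = n ^ d}"

definition G_space :: "nat \<Rightarrow> (nat \<Rightarrow> real) \<Rightarrow> (nat \<Rightarrow> (nat \<Rightarrow> int) set) measure" where
  "G_space d c = (\<Pi>\<^sub>M n\<in>{1..}. measure_pmf (pmf_of_set (factor_set d c n)))"

end

theory Submission
  imports Defs "HOL-Real_Asymp.Real_Asymp"
begin

text \<open>With \<open>m = \<lfloor>c\<^sub>n n\<rfloor> \<ge> n\<close>, it suffices to find a bijection from \<open>S\<close> to the grid that moves every point of
  the scaled set \<open>(n/m) S\<close> by \<open>O(log n)\<close>, since distinct points of \<open>S\<close> have distance at least 1.
  Halve the source cube repeatedly, one coordinate at a time, down to side length about \<open>log n\<close> (in the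
  target scale), and halve the target cube in parallel, but in the ratio of the numbers of points of \<open>S\<close>,
  so that each target box has as much volume as its source box has points. Unless the counts deviate
  from their means by a relative error of order \<open>1/l\<close> at side length \<open>l\<close>, each cut contributes \<open>O(1)\<close>
  to the displacement, and there are at most \<open>log n\<close> cuts per coordinate. The expected count is of order
  \<open>l\<^sup>d\<close>, so such a deviation has probability \<open>exp(-\<Omega>(l\<^bsup>d-2\<^esup>)) \<le> exp(-\<Omega>((log n)\<^sup>2))\<close>, which beats the
  polynomially many boxes and is summable. Comparing volumes gives Hall's condition for the bipartite
  graph of nearby pairs, and the Borel-Cantelli lemma concludes.\<close>

section \<open>Hall's theorem\<close>

text \<open>Induction on \<open>A\<close>. A nonempty proper subset that is tight (as many
  neighbours as elements) is matched within its neighbourhood and the rest outside it; if none is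
  tight, any \<open>a\<close> may take any of its neighbours.\<close>

lemma hall_marriage:
  fixes N :: "'a \<Rightarrow> 'b set"
  assumes "finite A" and "\<And>a. a \<in> A \<Longrightarrow> finite (N a)"
    and "\<And>X. X \<subseteq> A \<Longrightarrow> card X \<le> card (\<Union> (N ` X))"
  shows "\<exists>f. inj_on f A \<and> (\<forall>a\<in>A. f a \<in> N a)"
  using assms
proof (induction A arbitrary: N rule: finite_psubset_induct)
  case (psubset A)
  note fin = \<open>finite A\<close> and finN = psubset.prems(1) and cond = psubset.prems(2)
  consider "A = {}"
    | (tight) X where "X \<noteq> {}" "X \<subset> A" "card (\<Union> (N ` X)) = card X"
    | (loose) "A \<noteq> {}" "\<And>X. X \<noteq> {} \<Longrightarrow> X \<subset> A \<Longrightarrow> card X < card (\<Union> (N ` X))"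
    using cond by (metis order_neq_le_trans psubset_imp_subset)
  then show ?case
  proof cases
    case 1
    then show ?thesis by simp
  next
    case tight
    let ?NX = "\<Union> (N ` X)"
    obtain f where f: "inj_on f X" "\<forall>a\<in>X. f a \<in> N a"
      using psubset.IH[OF tight(2), of N] finN cond tight(2) by (meson psubset_imp_subset subsetD subset_trans)
    \<comment> \<open>Hall's condition for \<open>X \<union> Y\<close>, less the tight equality for
      \<open>X\<close>.\<close>
    have "card Y \<le> card (\<Union> ((\<lambda>a. N a - ?NX) ` Y))" if Y: "Y \<subseteq> A - X" for Y
    proof -
      have fX: "finite X" "finite Y" using tight(2) Y fin by (auto intro: finite_subset)
      have sub: "X \<union> Y \<subseteq> A" using Y tight(2) by auto
      have "card X + card Y = card (X \<union> Y)"
        using fX Y by (subst card_Un_disjoint) auto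
      also have "\<dots> \<le> card (\<Union> (N ` (X \<union> Y)))" by (rule cond[OF sub])
      also have "\<Union> (N ` (X \<union> Y)) = ?NX \<union> \<Union> ((\<lambda>a. N a - ?NX) ` Y)" by auto
      also have "card \<dots> \<le> card ?NX + card (\<Union> ((\<lambda>a. N a - ?NX) ` Y))" by (rule card_Un_le)
      finally show ?thesis using tight(3) by simp
    qed
    moreover have "A - X \<subset> A" using tight(1,2) by blast
    ultimately obtain g where g: "inj_on g (A - X)" "\<forall>a\<in>A-X. g a \<in> N a - ?NX"
      using psubset.IH[of "A - X" "\<lambda>a. N a - ?NX"] finN tight(1,2)
      by (metis (no_types, lifting) DiffD1 finite_Diff)
    define h where "h = (\<lambda>a. if a \<in> X then f a else g a)"
    have "inj_on h A"
    proof (rule inj_onI)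
      fix a b assume ab: "a \<in> A" "b \<in> A" "h a = h b"
      have c1: "f a' \<in> ?NX" if "a' \<in> X" for a' using f(2) that by auto
      have c2: "g a' \<notin> ?NX" if "a' \<in> A" "a' \<notin> X" for a' using g(2) that by auto
      show "a = b"
        using ab f(1) g(1) c1 c2 unfolding h_def
        by (auto split: if_splits dest: inj_onD) (metis c1 c2)+
    qed
    moreover have "\<forall>a\<in>A. h a \<in> N a" using f(2) g(2) unfolding h_def by auto
    ultimately show ?thesis by blast
  next
    case loose
    then obtain a where a: "a \<in> A" by blast
    have "1 \<le> card (N a)" using cond[of "{a}"] a by simp
    then obtain b where b: "b \<in> N a" by (metis card.empty ex_in_conv not_one_le_zero)
    \<comment> \<open>Every nonempty proper subset has a neighbour to spare, which pays for the loss
      of \<open>b\<close>.\<close>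
    have "card Y \<le> card (\<Union> ((\<lambda>x. N x - {b}) ` Y))" if Y: "Y \<subseteq> A - {a}" for Y
    proof (cases "Y = {}")
      case False
      have "card Y < card (\<Union> (N ` Y))" using loose(2)[OF False] Y a by auto
      moreover have "card (\<Union> (N ` Y)) - 1 \<le> card (\<Union> (N ` Y) - {b})"
        using card_Diff1_le by (metis card_Diff_singleton diff_le_self order_refl card_Diff_singleton_if)
      moreover have "\<Union> ((\<lambda>x. N x - {b}) ` Y) = \<Union> (N ` Y) - {b}" by auto
      ultimately show ?thesis by simp
    qed simp
    then obtain g where g: "inj_on g (A - {a})" "\<forall>x\<in>A-{a}. g x \<in> N x - {b}"
      using psubset.IH[of "A - {a}" "\<lambda>x. N x - {b}"] finN a by auto
    have "inj_on (g(a := b)) A"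
      using g a unfolding inj_on_def by (auto; metis DiffI Diff_iff singletonD singletonI)
    moreover have "\<forall>x\<in>A. (g(a := b)) x \<in> N x" using g(2) b by auto
    ultimately show ?thesis by blast
  qed
qed

section \<open>Boxes of integer points\<close>

definition zbox :: "nat \<Rightarrow> (nat \<Rightarrow> int set) \<Rightarrow> (nat \<Rightarrow> int) set" where
  "zbox d I = {x \<in> zvecs d. \<forall>i<d. x i \<in> I i}"

lemma grid_eq_zbox: "grid d m = zbox d (\<lambda>_. {1..int m})"
  by (auto simp: grid_def zbox_def)

text \<open>Distributivity over a box, which is identified with \<open>PiE {..<d} I\<close> by
  exchanging the default \<open>undefined\<close> beyond \<open>d\<close> for 0. It yields
  cardinalities (constant 1) and total volumes (overlaps).\<close>

lemma sum_prod_zbox: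
  fixes f :: "nat \<Rightarrow> int \<Rightarrow> 'a :: comm_semiring_1"
  assumes "\<And>i. i < d \<Longrightarrow> finite (I i)"
  shows "(\<Sum>x\<in>zbox d I. \<Prod>i<d. f i (x i)) = (\<Prod>i<d. \<Sum>a\<in>I i. f i a)"
proof -
  have "(\<Prod>i<d. \<Sum>a\<in>I i. f i a) = (\<Sum>g\<in>PiE {..<d} I. \<Prod>i<d. f i (g i))"
    by (rule prod_sum_PiE) (use assms in auto)
  also have "\<dots> = (\<Sum>x\<in>zbox d I. \<Prod>i<d. f i (x i))"
    by (rule sum.reindex_bij_witness[where i = "\<lambda>x. restrict x {..<d}"
            and j = "\<lambda>g i. if i < d then g i else 0"])
      (auto simp: zbox_def zvecs_def PiE_def Pi_def extensional_def restrict_def fun_eq_iff intro!: prod.cong)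
  finally show ?thesis by simp
qed

lemma finite_zbox:
  assumes "\<And>i. i < d \<Longrightarrow> finite (I i)"
  shows "finite (zbox d I)"
proof (rule finite_surj)
  show "finite (PiE {..<d} I)" using assms by (intro finite_PiE) auto
  show "zbox d I \<subseteq> (\<lambda>g i. if i < d then g i else 0) ` PiE {..<d} I"
  proof
    fix x assume x: "x \<in> zbox d I"
    then have "x = (\<lambda>i. if i < d then restrict x {..<d} i else 0)"
      by (auto simp: zbox_def zvecs_def)
    moreover have "restrict x {..<d} \<in> PiE {..<d} I" using x by (auto simp: zbox_def)
    ultimately show "x \<in> (\<lambda>g i. if i < d then g i else 0) ` PiE {..<d} I" by blast
  qed
qed

lemma card_zbox:
  assumes "\<And>i. i < d \<Longrightarrow> finite (I i)"
  shows "card (zbox d I) = (\<Prod>i<d. card (I i))"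
  using sum_prod_zbox[of d I "\<lambda>_ _. 1 :: nat"] assms by simp

lemma finite_grid: "finite (grid d m)"
  unfolding grid_eq_zbox by (rule finite_zbox) simp

lemma card_grid: "card (grid d m) = m ^ d"
  unfolding grid_eq_zbox by (subst card_zbox) auto

section \<open>Concentration for uniform random subsets\<close>

text \<open>Cross-multiplied: the ratio of the binomial coefficients is the product of
  \<open>(N - i) / (M - i)\<close> over \<open>i < a\<close>, and no factor exceeds
  \<open>N / M\<close>.\<close>

lemma binomial_ratio_le:
  assumes "a \<le> N" "N \<le> M"
  shows "real ((M - a) choose (N - a)) * real M ^ a \<le> real N ^ a * real (M choose N)"
  using assms(1)
proof (induction a)
  case (Suc a)
  then have IH: "real ((M - a) choose (N - a)) * real M ^ a \<le> real N ^ a * real (M choose N)" and aN: "a < N" by auto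
  obtain M' N' where M': "M - a = Suc M'" and N': "N - a = Suc N'"
    using aN assms(2) by (metis Suc_diff_Suc order_less_le_trans)
  have e: "M - Suc a = M'" "N - Suc a = N'" using M' N' by auto
  have ab: "real (Suc M') * real (M' choose N') = real (Suc N') * real (Suc M' choose Suc N')"
    using Suc_times_binomial_eq[of M' N'] by (metis mult.commute of_nat_mult)
  have rat: "real M * real (Suc N') \<le> real N * real (Suc M')"
  proof -
    have "Suc M' = M - a" "Suc N' = N - a" using M' N' by auto
    then show ?thesis using assms(2) aN by (simp add: of_nat_diff algebra_simps mult_right_mono)
  qed
  have "real (Suc M') * (real (M' choose N') * real M ^ Suc a)
      = real M * real (Suc N') * (real (Suc M' choose Suc N') * real M ^ a)"
    using arg_cong[OF ab, of "\<lambda>z. real M ^ Suc a * z"] by (simp only: power_Suc mult_ac)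
  also have "\<dots> \<le> real N * real (Suc M') * (real (Suc M' choose Suc N') * real M ^ a)"
    by (intro mult_right_mono rat) auto
  also have "\<dots> \<le> real N * real (Suc M') * (real N ^ a * real (M choose N))"
    using IH unfolding M' N' by (intro mult_left_mono) auto
  finally have "real (Suc M') * (real (M' choose N') * real M ^ Suc a) \<le> real (Suc M') * (real N ^ Suc a * real (M choose N))"
    by (simp add: algebra_simps)
  then show ?case unfolding e by (simp only: mult_le_cancel_left_pos of_nat_0_less_iff zero_less_Suc)
qed simp

text \<open>Deleting \<open>A\<close> is a bijection onto the \<open>(N - card A)\<close>-subsets of
  \<open>U - A\<close>, so \<open>binomial_ratio_le\<close> compares the two counts.\<close>

lemma card_supersets_le:
  assumes "finite U" "N \<le> card U" "A \<subseteq> U" "U \<noteq> {}"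
  shows "real (card {S. S \<subseteq> U \<and> card S = N \<and> A \<subseteq> S})
      \<le> (real N / real (card U)) ^ card A * real (card {S. S \<subseteq> U \<and> card S = N})"
proof (cases "card A \<le> N")
  case True
  have fA: "finite A" using assms finite_subset by blast
  have "bij_betw (\<lambda>S. S - A) {S. S \<subseteq> U \<and> card S = N \<and> A \<subseteq> S} {T. T \<subseteq> U - A \<and> card T = N - card A}"
  proof (rule bij_betw_byWitness[where f' = "\<lambda>T. T \<union> A"])
    show "(\<lambda>S. S - A) ` {S. S \<subseteq> U \<and> card S = N \<and> A \<subseteq> S} \<subseteq> {T. T \<subseteq> U - A \<and> card T = N - card A}"
      using fA by (auto simp: card_Diff_subset)
    have "card (T \<union> A) = N" if "T \<subseteq> U - A" "card T = N - card A" for T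
    proof -
      have "finite T" using that assms(1) finite_subset by blast
      then show ?thesis using that True fA by (subst card_Un_disjoint) auto
    qed
    then show "(\<lambda>T. T \<union> A) ` {T. T \<subseteq> U - A \<and> card T = N - card A} \<subseteq> {S. S \<subseteq> U \<and> card S = N \<and> A \<subseteq> S}"
      using assms(3) by auto
  qed auto
  then have "card {S. S \<subseteq> U \<and> card S = N \<and> A \<subseteq> S} = (card U - card A) choose (N - card A)"
    using bij_betw_same_card n_subsets[of "U - A"] assms(1,3) fA by (fastforce simp: card_Diff_subset)
  moreover have "card {S. S \<subseteq> U \<and> card S = N} = card U choose N"
    using n_subsets[OF assms(1)] by simp
  moreover have "card U > 0" using assms by (simp add: card_gt_0_iff)
  ultimately show ?thesis
    using binomial_ratio_le[OF True assms(2)] by (simp add: field_simps)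
next
  case False
  then have *: "{S. S \<subseteq> U \<and> card S = N \<and> A \<subseteq> S} = {}"
    using assms(1) by (auto dest: card_mono[rotated] intro: finite_subset)
  show ?thesis unfolding * by simp
qed

lemma sum_Pow_power:
  fixes u :: real
  assumes "finite A"
  shows "(\<Sum>B\<in>Pow A. u ^ card B) = (1 + u) ^ card A"
  using prod_add[OF assms, of "\<lambda>_. u" "\<lambda>_. 1"] by (simp add: add.commute)

text \<open>Expanding over subsets \<open>A\<close> of \<open>Q\<close> and using \<open>P(A \<subseteq> S) \<le> p ^ card A\<close> shows that the count behaves no
  worse than a binomial one, although the points are drawn without replacement.\<close>

lemma mgf_uniform_subset:
  fixes u :: real
  assumes "finite U" "N \<le> card U" "Q \<subseteq> U" "U \<noteq> {}" "u \<ge> 0"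
  defines "F \<equiv> {S. S \<subseteq> U \<and> card S = N}"
  shows "(\<Sum>S\<in>F. (1 + u) ^ card (S \<inter> Q)) \<le> real (card F) * (1 + real N / real (card U) * u) ^ card Q"
proof -
  define p where "p = real N / real (card U)"
  have fQ: "finite Q" using assms finite_subset by blast
  have fF: "finite F" using assms(1) unfolding F_def by simp
  have "(\<Sum>S\<in>F. (1 + u) ^ card (S \<inter> Q)) = (\<Sum>S\<in>F. \<Sum>A\<in>Pow Q. if A \<subseteq> S then u ^ card A else 0)"
  proof (rule sum.cong[OF refl])
    fix S
    have "(1 + u) ^ card (S \<inter> Q) = (\<Sum>A\<in>Pow (S \<inter> Q). u ^ card A)"
      using fQ by (subst sum_Pow_power) auto
    also have "Pow (S \<inter> Q) = {A\<in>Pow Q. A \<subseteq> S}" by auto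
    also have "(\<Sum>A\<in>{A\<in>Pow Q. A \<subseteq> S}. u ^ card A) = (\<Sum>A\<in>Pow Q. if A \<subseteq> S then u ^ card A else 0)"
      using fQ by (intro sum.inter_filter) auto
    finally show "(1 + u) ^ card (S \<inter> Q) = \<dots>" .
  qed
  also have "\<dots> = (\<Sum>A\<in>Pow Q. \<Sum>S\<in>F. if A \<subseteq> S then u ^ card A else 0)"
    by (rule sum.swap)
  also have "\<dots> = (\<Sum>A\<in>Pow Q. u ^ card A * real (card {S\<in>F. A \<subseteq> S}))"
    using fF by (intro sum.cong refl) (simp add: sum.inter_filter[symmetric])
  also have "\<dots> \<le> (\<Sum>A\<in>Pow Q. u ^ card A * (p ^ card A * real (card F)))"
  proof (intro sum_mono mult_left_mono)
    fix A assume "A \<in> Pow Q"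
    then show "real (card {S\<in>F. A \<subseteq> S}) \<le> p ^ card A * real (card F)"
      using card_supersets_le[of U N A] assms unfolding p_def F_def by (auto simp: conj_assoc)
  qed (use assms in auto)
  also have "\<dots> = real (card F) * (\<Sum>A\<in>Pow Q. (p * u) ^ card A)"
    by (simp add: sum_distrib_left power_mult_distrib algebra_simps)
  also have "\<dots> = real (card F) * (1 + p * u) ^ card Q"
    using fQ by (simp add: sum_Pow_power)
  finally show ?thesis unfolding p_def .
qed

text \<open>Markov's inequality for counting measure.\<close>

lemma card_le_of_sum_ge:
  fixes g :: "'a \<Rightarrow> real"
  assumes "finite F" "B \<subseteq> F" "\<And>S. S \<in> F \<Longrightarrow> g S \<ge> 0" "\<And>S. S \<in> B \<Longrightarrow> g S \<ge> y"
  shows "real (card B) * y \<le> sum g F"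
proof -
  have "real (card B) * y = (\<Sum>S\<in>B. y)" by simp
  also have "\<dots> \<le> sum g B" using assms by (intro sum_mono) auto
  also have "\<dots> \<le> sum g F" using assms by (intro sum_mono2) auto
  finally show ?thesis .
qed

text \<open>Chernoff's method: Markov for \<open>exp t ^ card (S \<inter> Q)\<close>, then
  \<open>1 + x \<le> exp x\<close> and \<open>exp t \<le> 1 + t + t^2\<close> for
  \<open>0 \<le> t \<le> 1\<close>.\<close>

lemma upper_tail_uniform_subset:
  fixes \<delta> :: real
  assumes "finite U" "N \<le> card U" "Q \<subseteq> U" "U \<noteq> {}" "0 \<le> \<delta>" "\<delta> \<le> 1"
  defines "F \<equiv> {S. S \<subseteq> U \<and> card S = N}"
    and "\<mu> \<equiv> real N / real (card U) * real (card Q)"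
  shows "real (card {S\<in>F. real (card (S \<inter> Q)) \<ge> (1 + \<delta>) * \<mu>}) \<le> real (card F) * exp (- \<mu> * \<delta>\<^sup>2 / 4)"
proof -
  \<comment> \<open>Minimises the final exponent
    \<open>\<mu> * (t^2 - t * \<delta>)\<close>.\<close>
  define t where "t = \<delta> / 2"
  have t: "0 \<le> t" "t \<le> 1" using assms unfolding t_def by auto
  define p where "p = real N / real (card U)"
  have p: "p \<ge> 0" unfolding p_def by simp
  have mu: "\<mu> = p * real (card Q)" unfolding \<mu>_def p_def by simp
  have mu0: "\<mu> \<ge> 0" using p mu by simp
  have fF: "finite F" using assms(1) unfolding F_def by simp
  let ?B = "{S\<in>F. real (card (S \<inter> Q)) \<ge> (1 + \<delta>) * \<mu>}"
  have pw: "exp t ^ k = exp (t * real k)" for k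
    by (simp add: mult.commute flip: exp_of_nat_mult)
  have "real (card ?B) * exp (t * ((1 + \<delta>) * \<mu>)) \<le> (\<Sum>S\<in>F. (1 + (exp t - 1)) ^ card (S \<inter> Q))"
    using t by (intro card_le_of_sum_ge fF) (auto simp: pw intro!: mult_left_mono)
  also have "\<dots> \<le> real (card F) * (1 + p * (exp t - 1)) ^ card Q"
    using mgf_uniform_subset[OF assms(1-4), of "exp t - 1"] t unfolding F_def p_def by simp
  also have "\<dots> \<le> real (card F) * (exp (p * (exp t - 1))) ^ card Q"
  proof (intro mult_left_mono power_mono)
    show "1 + p * (exp t - 1) \<le> exp (p * (exp t - 1))" by (rule exp_ge_add_one_self)
    show "0 \<le> 1 + p * (exp t - 1)" using p t by simp
  qed auto
  also have "(exp (p * (exp t - 1))) ^ card Q = exp (\<mu> * (exp t - 1))"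
    unfolding mu by (simp add: algebra_simps flip: exp_of_nat_mult)
  also have "\<dots> \<le> exp (\<mu> * (t + t\<^sup>2))"
    using exp_bound[OF t] mu0 by (auto intro!: mult_left_mono)
  finally have *: "real (card ?B) * exp (t * ((1 + \<delta>) * \<mu>)) \<le> real (card F) * exp (\<mu> * (t + t\<^sup>2))"
    by (simp add: mult_left_mono)
  have "real (card ?B) = real (card ?B) * exp (t * ((1 + \<delta>) * \<mu>)) * exp (- (t * ((1 + \<delta>) * \<mu>)))"
    by (simp add: mult.assoc flip: exp_add)
  also have "\<dots> \<le> real (card F) * exp (\<mu> * (t + t\<^sup>2)) * exp (- (t * ((1 + \<delta>) * \<mu>)))"
    by (intro mult_right_mono *) auto
  also have "\<dots> = real (card F) * exp (\<mu> * (t + t\<^sup>2) - t * ((1 + \<delta>) * \<mu>))"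
    by (simp add: mult.assoc flip: exp_add)
  also have "\<mu> * (t + t\<^sup>2) - t * ((1 + \<delta>) * \<mu>) = - \<mu> * \<delta>\<^sup>2 / 4"
    unfolding t_def by (simp add: power2_eq_square field_simps)
  finally show ?thesis .
qed

text \<open>\<open>(1 - t + t^2) * (1 + t) = 1 + t^3 \<ge> 1\<close>, and
  \<open>1 + t \<le> exp t\<close>.\<close>

lemma exp_minus_le: "exp (- t) \<le> 1 - t + t\<^sup>2" if "t \<ge> 0" for t :: real
proof -
  have "1 \<le> (1 - t + t\<^sup>2) * (1 + t)"
    using that by (simp add: power2_eq_square algebra_simps)
  also have "\<dots> \<le> (1 - t + t\<^sup>2) * exp t"
  proof (intro mult_left_mono exp_ge_add_one_self)
    have "1 - t + t\<^sup>2 = (1/2 - t)\<^sup>2 + 3/4" by (simp add: power2_eq_square algebra_simps)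
    then show "0 \<le> 1 - t + t\<^sup>2" by (metis add_nonneg_nonneg zero_le_power2 zero_le_divide_iff zero_le_numeral)
  qed
  finally show ?thesis by (simp add: exp_minus field_simps)
qed

text \<open>The complement of a uniform subset is again a uniform subset, and its count in \<open>Q\<close> has an upper
  exponential moment bound, which is a lower one for \<open>S\<close>.\<close>

lemma lower_tail_uniform_subset:
  fixes \<delta> :: real
  assumes "finite U" "N \<le> card U" "Q \<subseteq> U" "U \<noteq> {}" "0 \<le> \<delta>" "\<delta> \<le> 1"
  defines "F \<equiv> {S. S \<subseteq> U \<and> card S = N}"
    and "\<mu> \<equiv> real N / real (card U) * real (card Q)"
  shows "real (card {S\<in>F. real (card (S \<inter> Q)) \<le> (1 - \<delta>) * \<mu>}) \<le> real (card F) * exp (- \<mu> * \<delta>\<^sup>2 / 4)"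
proof -
  define t where "t = \<delta> / 2"
  have t: "0 \<le> t" "t \<le> 1" using assms unfolding t_def by auto
  define p where "p = real N / real (card U)"
  have cU: "card U > 0" using assms by (simp add: card_gt_0_iff)
  have p: "p \<ge> 0" "p \<le> 1" unfolding p_def using assms(2) cU by auto
  have mu: "\<mu> = p * real (card Q)" unfolding \<mu>_def p_def by simp
  have mu0: "\<mu> \<ge> 0" using p mu by simp
  have fF: "finite F" using assms(1) unfolding F_def by simp
  have fQ: "finite Q" using assms finite_subset by blast
  define F' where "F' = {S. S \<subseteq> U \<and> card S = card U - N}"
  have bij: "bij_betw (\<lambda>S. U - S) F F'"
  proof (rule bij_betw_byWitness[where f' = "\<lambda>S. U - S"])
    show "(\<lambda>S. U - S) ` F \<subseteq> F'" "(\<lambda>S. U - S) ` F' \<subseteq> F"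
      unfolding F_def F'_def using assms(1,2)
      by (auto simp: card_Diff_subset finite_subset)
  qed (auto simp: F_def F'_def)
  have cF: "card F' = card F" using bij bij_betw_same_card by metis
  let ?B = "{S\<in>F. real (card (S \<inter> Q)) \<le> (1 - \<delta>) * \<mu>}"
  have pw: "exp t ^ k = exp (t * real k)" for k
    by (simp add: mult.commute flip: exp_of_nat_mult)
  have "real (card ?B) * exp (t * (real (card Q) - (1 - \<delta>) * \<mu>)) \<le> (\<Sum>S\<in>F. (1 + (exp t - 1)) ^ card ((U - S) \<inter> Q))"
  proof (intro card_le_of_sum_ge fF)
    fix S assume S: "S \<in> ?B"
    have "(U - S) \<inter> Q = Q - S \<inter> Q" using assms(3) by auto
    then have "card ((U - S) \<inter> Q) = card Q - card (S \<inter> Q)"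
      using fQ by (simp add: card_Diff_subset)
    moreover have "card (S \<inter> Q) \<le> card Q" using fQ by (simp add: card_mono)
    ultimately have "real (card ((U - S) \<inter> Q)) \<ge> real (card Q) - (1 - \<delta>) * \<mu>"
      using S by (simp add: of_nat_diff)
    then show "exp (t * (real (card Q) - (1 - \<delta>) * \<mu>)) \<le> (1 + (exp t - 1)) ^ card ((U - S) \<inter> Q)"
      using t by (auto simp: pw intro!: mult_left_mono)
  qed auto
  also have "\<dots> = (\<Sum>S\<in>F'. (1 + (exp t - 1)) ^ card (S \<inter> Q))"
    by (rule sum.reindex_bij_betw[OF bij])
  also have "\<dots> \<le> real (card F) * (1 + (1 - p) * (exp t - 1)) ^ card Q"
    using mgf_uniform_subset[OF assms(1) _ assms(3,4), of "card U - N" "exp t - 1"] t cU assms(2)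
    unfolding cF[symmetric] unfolding F'_def p_def by (simp add: of_nat_diff diff_divide_distrib)
  \<comment> \<open>Splitting off \<open>exp t\<close> per point of \<open>Q\<close> cancels the
    \<open>card Q\<close> in the threshold and leaves the moment of a binomial count with parameter
    \<open>p\<close> at \<open>- t\<close>.\<close>
  also have "1 + (1 - p) * (exp t - 1) = exp t * (1 + p * (exp (- t) - 1))"
    by (simp add: algebra_simps exp_minus)
  also have "(exp t * (1 + p * (exp (- t) - 1))) ^ card Q = exp (t * real (card Q)) * (1 + p * (exp (- t) - 1)) ^ card Q"
    by (simp only: power_mult_distrib pw)
  also have "real (card F) * \<dots> \<le> real (card F) * (exp (t * real (card Q)) * (exp (p * (exp (- t) - 1))) ^ card Q)"
  proof (intro mult_left_mono power_mono)
    show "1 + p * (exp (- t) - 1) \<le> exp (p * (exp (- t) - 1))" by (rule exp_ge_add_one_self)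
    have "p * (1 - exp (- t)) \<le> 1 * 1" using p t by (intro mult_mono) auto
    then show "0 \<le> 1 + p * (exp (- t) - 1)" by (simp add: algebra_simps)
  qed auto
  also have "(exp (p * (exp (- t) - 1))) ^ card Q = exp (\<mu> * (exp (- t) - 1))"
    unfolding mu by (simp add: algebra_simps flip: exp_of_nat_mult)
  also have "\<dots> \<le> exp (\<mu> * (t\<^sup>2 - t))"
    using exp_minus_le[OF t(1)] mu0 by (auto intro!: mult_left_mono)
  finally have *: "real (card ?B) * exp (t * (real (card Q) - (1 - \<delta>) * \<mu>))
      \<le> real (card F) * (exp (t * real (card Q)) * exp (\<mu> * (t\<^sup>2 - t)))"
    by (simp add: mult_left_mono)
  let ?e = "t * (real (card Q) - (1 - \<delta>) * \<mu>)"
  have "real (card ?B) = real (card ?B) * exp ?e * exp (- ?e)"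
    by (simp add: mult.assoc flip: exp_add)
  also have "\<dots> \<le> real (card F) * (exp (t * real (card Q)) * exp (\<mu> * (t\<^sup>2 - t))) * exp (- ?e)"
    by (intro mult_right_mono *) auto
  also have "\<dots> = real (card F) * exp (t * real (card Q) + \<mu> * (t\<^sup>2 - t) - ?e)"
    by (simp add: mult.assoc flip: exp_add)
  also have "t * real (card Q) + \<mu> * (t\<^sup>2 - t) - ?e = - \<mu> * \<delta>\<^sup>2 / 4"
    unfolding t_def by (simp add: power2_eq_square field_simps)
  finally show ?thesis .
qed

section \<open>Matching by recursive halving\<close>

text \<open>The lattice points of the \<open>j\<close>-th dyadic interval of level \<open>k\<close> in \<open>(0, m]\<close>; no divisibility of \<open>m\<close> is
  assumed, so the counts are off by up to one.\<close>

definition cell :: "nat \<Rightarrow> nat \<Rightarrow> nat \<Rightarrow> int set" where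
  "cell m k j = {\<lfloor>real j * real m / 2 ^ k\<rfloor><..\<lfloor>real (Suc j) * real m / 2 ^ k\<rfloor>}"

lemma finite_cell: "finite (cell m k j)"
  by (simp add: cell_def)

lemma cell_0_0: "cell m 0 0 = {1..int m}"
  by (auto simp: cell_def)

text \<open>Level-\<open>k\<close> endpoints recur among those of level \<open>k + 1\<close> and are
  rounded the same way, so the halves fit exactly for every \<open>m\<close>.\<close>

lemma cell_Suc: "cell m (Suc k) (2 * j) \<union> cell m (Suc k) (2 * j + 1) = cell m k j"
  and cell_Suc_disjoint: "cell m (Suc k) (2 * j) \<inter> cell m (Suc k) (2 * j + 1) = {}"
proof -
  have e: "real (2 * j) * real m / 2 ^ Suc k = real j * real m / 2 ^ k"
    "real (Suc (2 * j + 1)) * real m / 2 ^ Suc k = real (Suc j) * real m / 2 ^ k"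
    by (simp_all add: field_simps)
  have "real j * real m / 2 ^ k \<le> real (Suc (2 * j)) * real m / 2 ^ Suc k"
    "real (Suc (2 * j)) * real m / 2 ^ Suc k \<le> real (Suc j) * real m / 2 ^ k"
    by (simp_all add: field_simps)
  then have "\<lfloor>real j * real m / 2 ^ k\<rfloor> \<le> \<lfloor>real (Suc (2 * j)) * real m / 2 ^ Suc k\<rfloor>"
    "\<lfloor>real (Suc (2 * j)) * real m / 2 ^ Suc k\<rfloor> \<le> \<lfloor>real (Suc j) * real m / 2 ^ k\<rfloor>"
    by (simp_all add: floor_mono)
  then show "cell m (Suc k) (2 * j) \<union> cell m (Suc k) (2 * j + 1) = cell m k j"
    unfolding cell_def e by (auto simp: ivl_disj_un_two)
  show "cell m (Suc k) (2 * j) \<inter> cell m (Suc k) (2 * j + 1) = {}"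
    unfolding cell_def by auto
qed

lemma card_cell: "\<bar>real (card (cell m k j)) - real m / 2 ^ k\<bar> \<le> 1"
proof -
  let ?a = "real j * real m / 2 ^ k" and ?b = "real (Suc j) * real m / 2 ^ k"
  have ab: "?b = ?a + real m / 2 ^ k" by (simp add: field_simps)
  have "\<lfloor>?a\<rfloor> \<le> \<lfloor>?b\<rfloor>" unfolding ab by (intro floor_mono) simp
  then have "real (card (cell m k j)) = of_int \<lfloor>?b\<rfloor> - of_int \<lfloor>?a\<rfloor>"
    unfolding cell_def by simp
  moreover have "?a - 1 < of_int \<lfloor>?a\<rfloor>" "of_int \<lfloor>?a\<rfloor> \<le> ?a" "?b - 1 < of_int \<lfloor>?b\<rfloor>" "of_int \<lfloor>?b\<rfloor> \<le> ?b"
    by linarith+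
  ultimately show ?thesis using ab by linarith
qed

lemma cell_bounds:
  assumes "a \<in> cell m k j"
  shows "real j * real m / 2 ^ k \<le> of_int a" "of_int a \<le> real (Suc j) * real m / 2 ^ k"
  using assms unfolding cell_def by (auto simp: le_floor_iff floor_less_iff)

text \<open>Levels are kept per coordinate because the sides are halved one at a time.\<close>

definition dbox :: "nat \<Rightarrow> nat \<Rightarrow> (nat \<Rightarrow> nat) \<Rightarrow> (nat \<Rightarrow> nat) \<Rightarrow> (nat \<Rightarrow> int) set" where
  "dbox d m \<kappa> j = zbox d (\<lambda>i. cell m (\<kappa> i) (j i))"

lemma card_dbox: "card (dbox d m \<kappa> j) = (\<Prod>i<d. card (cell m (\<kappa> i) (j i)))"
  unfolding dbox_def by (intro card_zbox finite_cell)

lemma finite_dbox: "finite (dbox d m \<kappa> j)"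
  unfolding dbox_def by (intro finite_zbox finite_cell)

lemma dbox_split:
  assumes "i < d"
  shows "dbox d m (\<kappa>(i := Suc (\<kappa> i))) (j(i := 2 * j i)) \<union>
      dbox d m (\<kappa>(i := Suc (\<kappa> i))) (j(i := 2 * j i + 1)) = dbox d m \<kappa> j" (is "?A \<union> ?B = ?C")
    and "dbox d m (\<kappa>(i := Suc (\<kappa> i))) (j(i := 2 * j i)) \<inter>
      dbox d m (\<kappa>(i := Suc (\<kappa> i))) (j(i := 2 * j i + 1)) = {}"
proof -
  have mem: "x \<in> dbox d m (\<kappa>(i := k)) (j(i := l)) \<longleftrightarrow>
      x \<in> zvecs d \<and> x i \<in> cell m k l \<and> (\<forall>i'<d. i' \<noteq> i \<longrightarrow> x i' \<in> cell m (\<kappa> i') (j i'))" for x k l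
    using assms by (auto simp: dbox_def zbox_def)
  have mem': "x \<in> dbox d m \<kappa> j \<longleftrightarrow>
      x \<in> zvecs d \<and> x i \<in> cell m (\<kappa> i) (j i) \<and> (\<forall>i'<d. i' \<noteq> i \<longrightarrow> x i' \<in> cell m (\<kappa> i') (j i'))" for x
    using mem[of x "\<kappa> i" "j i"] by simp
  show "?A \<union> ?B = ?C"
    using cell_Suc[of m "\<kappa> i" "j i"] by (intro set_eqI) (auto simp: mem mem')
  show "?A \<inter> ?B = {}"
    using cell_Suc_disjoint[of m "\<kappa> i" "j i"] by (intro set_eqI) (auto simp: mem)
qed

section \<open>Mass of target points in real boxes\<close>

text \<open>Grid points \<open>a\<close> of the target stand for the unit intervals \<open>(a - 1, a]\<close>.\<close>

definition overlap :: "real \<Rightarrow> real \<Rightarrow> int \<Rightarrow> real" where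
  "overlap lo hi a = max 0 (min hi (of_int a) - max lo (of_int a - 1))"

lemma overlap_nonneg: "overlap lo hi a \<ge> 0"
  by (simp add: overlap_def)

lemma overlap_split:
  "lo \<le> mid \<Longrightarrow> mid \<le> hi \<Longrightarrow> overlap lo hi a = overlap lo mid a + overlap mid hi a"
  unfolding overlap_def by (auto simp: max_def min_def)

text \<open>The unit interval of \<open>a\<close> may begin below \<open>hi\<close> and end beyond
  it; hence the \<open>+ 1\<close> in the matching radius.\<close>

lemma overlap_pos_bounds: "overlap lo hi a > 0 \<Longrightarrow> lo < of_int a \<and> of_int a < hi + 1"
  unfolding overlap_def by (auto simp: max_def min_def split: if_splits)

lemma sum_overlap_le:
  assumes "lo \<le> hi"
  shows "(\<Sum>a\<in>{1..int n}. overlap lo hi a) \<le> hi - lo"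
proof -
  \<comment> \<open>The length of the part in \<open>[0, n]\<close>; unlike \<open>hi - lo\<close>
    it grows with \<open>n\<close>, so the induction closes.\<close>
  have "(\<Sum>a\<in>{1..int n}. overlap lo hi a) \<le> max 0 (min hi (real n) - max lo 0)"
  proof (induction n)
    case (Suc n)
    have "{1..int (Suc n)} = insert (int (Suc n)) {1..int n}" by auto
    then show ?case using Suc assms by (auto simp: overlap_def max_def min_def split: if_splits)
  qed simp
  then show ?thesis using assms by (auto simp: max_def min_def split: if_splits)
qed

text \<open>Volume common to the box and the unit cube of \<open>g\<close>, so each grid point
  carries total mass 1.\<close>

definition cube_overlap :: "nat \<Rightarrow> (nat \<Rightarrow> real) \<Rightarrow> (nat \<Rightarrow> real) \<Rightarrow> (nat \<Rightarrow> int) \<Rightarrow> real" where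
  "cube_overlap d lo hi g = (\<Prod>i<d. overlap (lo i) (hi i) (g i))"

lemma cube_overlap_nonneg: "cube_overlap d lo hi g \<ge> 0"
  by (auto simp: cube_overlap_def intro!: prod_nonneg overlap_nonneg)

text \<open>Isolates the side being cut; used alike for lattice counts, overlaps and
  volumes.\<close>

lemma prod_fun_upd_split:
  fixes f :: "nat \<Rightarrow> 'a \<Rightarrow> 'b \<Rightarrow> 'c :: comm_monoid_mult"
  assumes "i < d"
  shows "(\<Prod>i'<d. f i' ((u(i := a)) i') ((v(i := b)) i')) = f i a b * (\<Prod>i'\<in>{..<d}-{i}. f i' (u i') (v i'))"
proof -
  have "(\<Prod>i'<d. f i' ((u(i := a)) i') ((v(i := b)) i'))
      = f i ((u(i := a)) i) ((v(i := b)) i) * (\<Prod>i'\<in>{..<d}-{i}. f i' ((u(i := a)) i') ((v(i := b)) i'))"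
    by (rule prod.remove) (use assms in auto)
  also have "(\<Prod>i'\<in>{..<d}-{i}. f i' ((u(i := a)) i') ((v(i := b)) i')) = (\<Prod>i'\<in>{..<d}-{i}. f i' (u i') (v i'))"
    by (intro prod.cong) auto
  finally show ?thesis by simp
qed

lemma cube_overlap_split:
  assumes "i < d" "lo i \<le> mid" "mid \<le> hi i"
  shows "cube_overlap d lo hi g = cube_overlap d lo (hi(i := mid)) g + cube_overlap d (lo(i := mid)) hi g"
proof -
  have *: "cube_overlap d (lo(i := a)) (hi(i := b)) g
      = overlap a b (g i) * (\<Prod>i'\<in>{..<d}-{i}. overlap (lo i') (hi i') (g i'))" for a b
    unfolding cube_overlap_def by (rule prod_fun_upd_split[where f = "\<lambda>i a b. overlap a b (g i)", OF assms(1)])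
  show ?thesis
    using *[of "lo i" "hi i"] *[of "lo i" mid] *[of mid "hi i"] overlap_split[OF assms(2,3), of "g i"]
    by (simp add: distrib_right)
qed

lemma sum_cube_overlap_le:
  assumes "\<And>i. i < d \<Longrightarrow> lo i \<le> hi i" "G \<subseteq> grid d n"
  shows "(\<Sum>g\<in>G. cube_overlap d lo hi g) \<le> (\<Prod>i<d. hi i - lo i)"
proof -
  have "(\<Sum>g\<in>G. cube_overlap d lo hi g) \<le> (\<Sum>g\<in>grid d n. cube_overlap d lo hi g)"
    using assms(2) by (intro sum_mono2 finite_grid) (auto intro: cube_overlap_nonneg)
  also have "\<dots> = (\<Prod>i<d. \<Sum>a\<in>{1..int n}. overlap (lo i) (hi i) a)"
    unfolding grid_eq_zbox cube_overlap_def by (intro sum_prod_zbox) auto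
  also have "\<dots> \<le> (\<Prod>i<d. hi i - lo i)"
    using assms(1) by (intro prod_mono) (auto intro: sum_overlap_le sum_nonneg overlap_nonneg)
  finally show ?thesis .
qed

section \<open>Displacement caused by one cut\<close>

text \<open>\<open>P0\<close>, \<open>P1\<close> are the expected and \<open>N0\<close>,
  \<open>N1\<close> the observed counts of the two halves, \<open>l\<close> is the ideal target side
  and \<open>q\<close> the number of lattice layers across the source side. Rounding makes the
  expected counts differ by at most two layers, a share \<open>2 / q\<close>; the deviations add a
  share \<open>1 / l\<close>.\<close>

lemma split_ratio_bound:
  fixes N0 N1 P0 P1 q l :: real
  assumes "l \<ge> 20" "q \<ge> l - 1" "P0 + P1 > 0" "\<bar>N0 - P0\<bar> \<le> P0 / l" "\<bar>N1 - P1\<bar> \<le> P1 / l"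
    and "\<bar>P0 - P1\<bar> * q \<le> 2 * (P0 + P1)"
  shows "\<bar>N0 / (N0 + N1) - 1/2\<bar> \<le> 5 / l" "N0 + N1 > 0"
proof -
  define P where "P = P0 + P1"
  have P: "P > 0" using assms(3) P_def by simp
  have l: "l > 0" using assms(1) by simp
  have s: "P0 / l + P1 / l = P / l" by (simp add: P_def add_divide_distrib)
  have Pl: "P / l \<le> P / 20" using P assms(1) by (intro divide_left_mono) auto
  \<comment> \<open>\<open>19/20\<close> is \<open>1 - 1/l\<close> at \<open>l = 20\<close>; the
    same factor compares \<open>l - 1\<close> with \<open>l\<close> below.\<close>
  have N: "N0 + N1 \<ge> 19/20 * P" using assms(4,5) s Pl P_def by linarith
  then show N': "N0 + N1 > 0" using P by simp
  have q: "19/20 * l \<le> q" using assms(1,2) by linarith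
  have "\<bar>P0 - P1\<bar> * (19/20 * l) \<le> \<bar>P0 - P1\<bar> * q" by (intro mult_left_mono q) auto
  also have "\<dots> \<le> 2 * P" using assms(6) P_def by simp
  finally have "\<bar>P0 - P1\<bar> \<le> 3 * (P / l)" using l P by (simp add: field_simps)
  then have d: "\<bar>N0 - N1\<bar> \<le> 4 * (P / l)" using assms(4,5) s by linarith
  have "N0 / (N0 + N1) - 1/2 = (N0 - N1) / (2 * (N0 + N1))" using N' by (simp add: field_simps)
  then have "\<bar>N0 / (N0 + N1) - 1/2\<bar> = \<bar>N0 - N1\<bar> / (2 * (N0 + N1))" using N' by simp
  also have "\<dots> \<le> 4 * (P / l) / (2 * (19/20 * P))"
    using d N P l by (intro frac_le) auto
  also have "\<dots> \<le> 5 / l" using P l by (simp add: field_simps)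
  finally show "\<bar>N0 / (N0 + N1) - 1/2\<bar> \<le> 5 / l" .
qed

text \<open>The tolerance \<open>2 ^ k / n\<close> is the reciprocal of the side length of a level-\<open>k\<close> target box, so that
  halving such a box in the ratio of the observed counts displaces the cut by a bounded amount.\<close>

definition regular_set :: "nat \<Rightarrow> nat \<Rightarrow> nat \<Rightarrow> nat \<Rightarrow> real \<Rightarrow> (nat \<Rightarrow> int) set \<Rightarrow> bool" where
  "regular_set d n m K p S \<longleftrightarrow> (\<forall>k \<kappa> j.
     (\<forall>i<d. k \<le> \<kappa> i \<and> \<kappa> i \<le> Suc k \<and> \<kappa> i \<le> K \<and> j i < 2 ^ \<kappa> i) \<longrightarrow>
     \<bar>real (card (S \<inter> dbox d m \<kappa> j)) - p * real (card (dbox d m \<kappa> j))\<bar>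
       \<le> p * real (card (dbox d m \<kappa> j)) / (real n / 2 ^ k))"

definition near :: "nat \<Rightarrow> nat \<Rightarrow> nat \<Rightarrow> real \<Rightarrow> (nat \<Rightarrow> int) \<Rightarrow> (nat \<Rightarrow> int) \<Rightarrow> bool" where
  "near d n m R x g \<longleftrightarrow> (\<forall>i<d. \<bar>of_int (g i) - real n / real m * of_int (x i)\<bar> \<le> R)"

text \<open>The midpoint inherits the error \<open>e\<close> of the ends; the unequal ratio adds at
  most \<open>(hi - lo) * 5 / l\<close>, and \<open>2 * e \<le> l\<close> keeps
  \<open>hi - lo\<close> within \<open>2 * l\<close>.\<close>

lemma mid_deviation:
  fixes l lo hi lo' hi' r e :: real
  assumes "\<bar>lo - lo'\<bar> \<le> e" "\<bar>hi - hi'\<bar> \<le> e" "hi' - lo' = l" "2 * e \<le> l" "l > 0" "\<bar>r - 1/2\<bar> \<le> 5 / l"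
  shows "\<bar>lo + (hi - lo) * r - (lo' + hi') / 2\<bar> \<le> e + 10"
proof -
  have hl: "0 \<le> hi - lo" "hi - lo \<le> 2 * l" using assms by linarith+
  have "\<bar>(hi - lo) * (r - 1/2)\<bar> \<le> (2 * l) * (5 / l)"
    unfolding abs_mult using hl assms(5,6) by (intro mult_mono) auto
  also have "\<dots> = 10" using assms(5) by simp
  finally have "\<bar>(hi - lo) * (r - 1/2)\<bar> \<le> 10" .
  moreover have eq: "lo + (hi - lo) * r - (lo' + hi') / 2 = (lo - lo') / 2 + (hi - hi') / 2 + (hi - lo) * (r - 1/2)"
    by (simp add: field_simps)
  moreover have "\<bar>a / 2 + b / 2 + t\<bar> \<le> e + 10"
    if "\<bar>a\<bar> \<le> e" "\<bar>b\<bar> \<le> e" "\<bar>t\<bar> \<le> 10" for a b t :: real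
    using that by linarith
  ultimately show ?thesis unfolding eq using assms(1,2) by blast
qed

text \<open>The box with corners \<open>lo\<close>, \<open>hi\<close> is the target of the source box \<open>dbox d m \<kappa> j\<close>; its volume is
  exactly the number of points of \<open>S\<close> to be placed in it. Both sides of the claim are additive under
  cutting the longest side of the source box in half and cutting the target in the ratio of the two
  counts. Each cut moves the faces by at most 10 further away from their ideal dyadic positions.\<close>

lemma hall_condition_dbox:
  assumes mn: "n \<le> m" "n > 0" and p: "p > 0"
    and l: "20 \<le> real n / 2 ^ K" "20 * real K \<le> real n / 2 ^ K"
    and reg: "regular_set d n m K p S" and fS: "finite S" and G: "G \<subseteq> grid d n"
    and bal: "\<And>i i'. i < d \<Longrightarrow> i' < d \<Longrightarrow> \<kappa> i' \<le> Suc (\<kappa> i)"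
    and K: "\<And>i. i < d \<Longrightarrow> \<kappa> i \<le> K" and j: "\<And>i. i < d \<Longrightarrow> j i < 2 ^ \<kappa> i"
    and lo: "\<And>i. i < d \<Longrightarrow> \<bar>lo i - real n * real (j i) / 2 ^ \<kappa> i\<bar> \<le> 10 * real (\<kappa> i)"
    and hi: "\<And>i. i < d \<Longrightarrow> \<bar>hi i - real n * real (Suc (j i)) / 2 ^ \<kappa> i\<bar> \<le> 10 * real (\<kappa> i)"
    and vol: "(\<Prod>i<d. hi i - lo i) = real (card (S \<inter> dbox d m \<kappa> j))"
  shows "(\<Sum>g\<in>G. cube_overlap d lo hi g)
      \<le> real (card {x \<in> S \<inter> dbox d m \<kappa> j. \<exists>g\<in>G. near d n m (real n / 2 ^ K + 10 * real K + 1) x g})"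
  using bal K j lo hi vol
\<comment> \<open>Induction on the number of cuts still to be made.\<close>
proof (induction "\<Sum>i<d. K - \<kappa> i" arbitrary: \<kappa> j lo hi rule: less_induct)
  case less
  note bal = less.prems(1) and K = less.prems(2) and j = less.prems(3)
    and lo = less.prems(4) and hi = less.prems(5) and vol = less.prems(6)
  define R where "R = real n / 2 ^ K + 10 * real K + 1"
  have lK: "real n / 2 ^ K \<le> real n / 2 ^ \<kappa> i" if "i < d" for i
    using K[OF that] by (intro divide_left_mono power_increasing) auto
  have lk: "20 * real (\<kappa> i) \<le> real n / 2 ^ \<kappa> i" if "i < d" for i
  proof -
    have "20 * real (\<kappa> i) \<le> 20 * real K" using K[OF that] by simp
    then show ?thesis using l(2) lK[OF that] by linarith
  qed
  have diff: "real n * real (Suc (j i)) / 2 ^ \<kappa> i - real n * real (j i) / 2 ^ \<kappa> i = real n / 2 ^ \<kappa> i" for i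
    by (simp add: field_simps)
  have lohi: "lo i \<le> hi i" if "i < d" for i
    using lo[OF that] hi[OF that] lk[OF that] diff[of i] by linarith
  show ?case
  proof (cases "\<forall>i<d. \<kappa> i = K")
    case True
    show ?thesis
    \<comment> \<open>If some unit cube of \<open>G\<close> meets the target box, its grid point is
      near every point of the source box; then all points of \<open>S\<close> there are counted, and
      their number is the volume.\<close>
    proof (cases "\<exists>g\<in>G. cube_overlap d lo hi g > 0")
      case False
      then have "(\<Sum>g\<in>G. cube_overlap d lo hi g) \<le> 0" by (intro sum_nonpos) auto
      then show ?thesis by (meson of_nat_0_le_iff order_trans)
    next
      case True
      then obtain g where g: "g \<in> G" "cube_overlap d lo hi g > 0" by blast
      have "near d n m R x g" if x: "x \<in> dbox d m \<kappa> j" for x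
        unfolding near_def
      proof (intro allI impI)
        fix i assume i: "i < d"
        have "overlap (lo i) (hi i) (g i) \<noteq> 0"
          using g(2) i unfolding cube_overlap_def by (metis finite_lessThan lessThan_iff less_irrefl prod_zero)
        then have o: "lo i < of_int (g i) \<and> of_int (g i) < hi i + 1"
          using overlap_nonneg[of "lo i" "hi i" "g i"] by (intro overlap_pos_bounds) simp
        have "x i \<in> cell m (\<kappa> i) (j i)" using x i by (auto simp: dbox_def zbox_def)
        note cb = cell_bounds[OF this]
        have m0: "real m > 0" using mn by simp
        have "real n / real m * (real (j i) * real m / 2 ^ \<kappa> i) \<le> real n / real m * of_int (x i)"
          by (intro mult_left_mono cb) auto
        moreover have "real n / real m * of_int (x i) \<le> real n / real m * (real (Suc (j i)) * real m / 2 ^ \<kappa> i)"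
          by (intro mult_left_mono cb) auto
        ultimately have "real n * real (j i) / 2 ^ \<kappa> i \<le> real n / real m * of_int (x i)"
          "real n / real m * of_int (x i) \<le> real n * real (Suc (j i)) / 2 ^ \<kappa> i"
          using m0 by (simp_all add: mult.commute)
        \<comment> \<open>The radius adds up the ideal side \<open>n / 2 ^ K\<close>, the corner
          error \<open>10 * K\<close> and the 1 from the unit cube.\<close>
        then show "\<bar>of_int (g i) - real n / real m * of_int (x i)\<bar> \<le> R"
          using o lo[OF i] hi[OF i] diff[of i] \<open>\<forall>i<d. \<kappa> i = K\<close> i unfolding R_def by auto
      qed
      then have "{x \<in> S \<inter> dbox d m \<kappa> j. \<exists>g\<in>G. near d n m R x g} = S \<inter> dbox d m \<kappa> j"
        using g(1) by blast
      moreover have "(\<Sum>g\<in>G. cube_overlap d lo hi g) \<le> (\<Prod>i<d. hi i - lo i)"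
        by (rule sum_cube_overlap_le[OF _ G]) (rule lohi)
      ultimately show ?thesis using vol unfolding R_def by simp
    qed
  next
    case False
    then obtain i0 where i0: "i0 < d" "\<kappa> i0 < K" using K by (meson order_le_neq_trans)
    \<comment> \<open>A least level is a longest side; cutting it keeps all levels within one of
      each other.\<close>
    obtain i where i: "i < d" "\<And>i'. i' < d \<Longrightarrow> \<kappa> i \<le> \<kappa> i'"
      using ex_has_least_nat[of "\<lambda>i. i < d" i0 \<kappa>] i0(1) by blast
    have iK: "\<kappa> i < K" using i(2)[OF i0(1)] i0(2) by simp
    let ?\<kappa> = "\<kappa>(i := Suc (\<kappa> i))"
    let ?jL = "j(i := 2 * j i)" and ?jR = "j(i := 2 * j i + 1)"
    let ?Q = "dbox d m \<kappa> j" and ?QL = "dbox d m ?\<kappa> ?jL" and ?QR = "dbox d m ?\<kappa> ?jR"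
    note spl = dbox_split[OF i(1), of m \<kappa> j]
    define q where "q = real (card (cell m (\<kappa> i) (j i)))"
    define q0 where "q0 = real (card (cell m (Suc (\<kappa> i)) (2 * j i)))"
    define q1 where "q1 = real (card (cell m (Suc (\<kappa> i)) (2 * j i + 1)))"
    define c where "c = (\<Prod>i'\<in>{..<d}-{i}. real (card (cell m (\<kappa> i') (j i'))))"
    define P0 where "P0 = p * real (card ?QL)"
    define P1 where "P1 = p * real (card ?QR)"
    define N0 where "N0 = real (card (S \<inter> ?QL))"
    define N1 where "N1 = real (card (S \<inter> ?QR))"
    let ?l = "real n / 2 ^ \<kappa> i"
    have cQ: "real (card (dbox d m (\<kappa>(i := a)) (j(i := b)))) = real (card (cell m a b)) * c" for a b
      unfolding card_dbox of_nat_prod c_def by (rule prod_fun_upd_split[OF i(1)])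
    have P01: "P0 = p * (q0 * c)" "P1 = p * (q1 * c)"
      unfolding P0_def P1_def cQ q0_def q1_def by simp_all
    have qq: "q = q0 + q1"
      unfolding q_def q0_def q1_def cell_Suc[symmetric, of m "\<kappa> i" "j i"] of_nat_add[symmetric]
      by (intro arg_cong[of _ _ real] card_Un_disjoint finite_cell cell_Suc_disjoint)
    have l20: "?l \<ge> 20" using l(1) lK[OF i(1)] by linarith
    have ml: "real n / 2 ^ k \<le> real m / 2 ^ k" for k using mn by (intro divide_right_mono) auto
    have cell_pos: "card (cell m (\<kappa> i') (j i')) > 0" if "i' < d" for i'
    proof -
      have "real (card (cell m (\<kappa> i') (j i'))) \<ge> 19"
        using card_cell[of m "\<kappa> i'" "j i'"] l(1) lK[OF that] ml[of "\<kappa> i'"] by linarith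
      then show ?thesis by linarith
    qed
    have cpos: "c > 0" unfolding c_def using cell_pos by (intro prod_pos) auto
    have ql: "q \<ge> ?l - 1"
      unfolding q_def using card_cell[of m "\<kappa> i" "j i"] ml[of "\<kappa> i"] by linarith
    \<comment> \<open>Each half is within 1 of \<open>m / 2 ^ Suc (\<kappa> i)\<close>.\<close>
    have q01: "\<bar>q0 - q1\<bar> \<le> 2"
      unfolding q0_def q1_def
      using card_cell[of m "Suc (\<kappa> i)" "2 * j i"] card_cell[of m "Suc (\<kappa> i)" "2 * j i + 1"] by linarith
    have Ppos: "P0 + P1 > 0"
    proof -
      have "P0 + P1 = p * c * q" unfolding P01 qq by (simp add: algebra_simps)
      then show ?thesis using p cpos ql l20 by simp
    qed
    have Pdiff: "\<bar>P0 - P1\<bar> * q \<le> 2 * (P0 + P1)"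
    proof -
      have "P0 - P1 = p * c * (q0 - q1)" unfolding P01 by (simp add: algebra_simps)
      then have "\<bar>P0 - P1\<bar> * q = p * c * q * \<bar>q0 - q1\<bar>" using p cpos by (simp add: abs_mult)
      also have "\<dots> \<le> p * c * q * 2" using p cpos ql l20 q01 by (intro mult_left_mono) auto
      also have "\<dots> = 2 * (P0 + P1)" unfolding P01 qq by (simp add: algebra_simps)
      finally show ?thesis .
    qed
    have bK: "\<kappa> i \<le> ?\<kappa> i' \<and> ?\<kappa> i' \<le> Suc (\<kappa> i) \<and> ?\<kappa> i' \<le> K \<and> ?jL i' < 2 ^ ?\<kappa> i' \<and> ?jR i' < 2 ^ ?\<kappa> i'"
      if "i' < d" for i'
    proof -
      have "2 * j i + 1 < 2 ^ Suc (\<kappa> i)" using j[OF i(1)] by (simp only: power_Suc)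
      then have *: "?jR i' < 2 ^ ?\<kappa> i'"
        using j[OF that] by (cases "i' = i") (simp_all only: fun_upd_apply simp_thms if_True if_False)
      have "\<kappa> i \<le> ?\<kappa> i' \<and> ?\<kappa> i' \<le> Suc (\<kappa> i) \<and> ?\<kappa> i' \<le> K \<and> ?jL i' < 2 ^ ?\<kappa> i'"
        using that i iK bal[of i i'] K j j[OF i(1)] by auto
      with * show ?thesis by blast
    qed
    \<comment> \<open>Regularity at \<open>k = \<kappa> i\<close>: by minimality of
      \<open>\<kappa> i\<close> and balance, both halves have only the levels
      \<open>\<kappa> i\<close> and \<open>\<kappa> i + 1\<close>.\<close>
    have N0: "\<bar>N0 - P0\<bar> \<le> P0 / ?l" and N1: "\<bar>N1 - P1\<bar> \<le> P1 / ?l"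
      unfolding N0_def N1_def P0_def P1_def
      by (rule reg[unfolded regular_set_def, THEN spec, THEN spec, THEN spec, THEN mp]; use bK in blast)+
    have NN: "real (card (S \<inter> ?Q)) = N0 + N1"
    proof -
      have "S \<inter> ?Q = (S \<inter> ?QL) \<union> (S \<inter> ?QR)" using spl(1) by blast
      then have "card (S \<inter> ?Q) = card (S \<inter> ?QL) + card (S \<inter> ?QR)"
        using fS card_Un_disjoint[of "S \<inter> ?QL" "S \<inter> ?QR"] spl(2)
        by (metis (no_types, lifting) Int_Un_distrib finite_Int inf_assoc inf_bot_right inf_left_commute)
      then show ?thesis by (simp add: N0_def N1_def)
    qed
    define r where "r = N0 / (N0 + N1)"
    have r: "\<bar>r - 1/2\<bar> \<le> 5 / ?l" and Npos: "N0 + N1 > 0"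
      using split_ratio_bound[OF l20 ql Ppos N0 N1 Pdiff] unfolding r_def by auto
    have r01: "0 \<le> r" "r \<le> 1" unfolding r_def N0_def N1_def by (auto simp: divide_le_eq_1)
    define mid where "mid = lo i + (hi i - lo i) * r"
    have mid: "lo i \<le> mid" "mid \<le> hi i"
    proof -
      have "0 \<le> (hi i - lo i) * r" "(hi i - lo i) * r \<le> hi i - lo i"
        using r01 lohi[OF i(1)] by (auto intro: mult_nonneg_nonneg mult_left_le)
      then show "lo i \<le> mid" "mid \<le> hi i" unfolding mid_def by linarith+
    qed
    \<comment> \<open>This is \<open>mid_deviation\<close> with \<open>e = 10 * \<kappa> i\<close>:
      the level gained by the cut pays for the extra 10.\<close>
    have middev: "\<bar>mid - real n * real (2 * j i + 1) / 2 ^ Suc (\<kappa> i)\<bar> \<le> 10 * real (Suc (\<kappa> i))"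
    proof -
      have "(real n * real (j i) / 2 ^ \<kappa> i + real n * real (Suc (j i)) / 2 ^ \<kappa> i) / 2
          = real n * real (2 * j i + 1) / 2 ^ Suc (\<kappa> i)" by (simp add: field_simps)
      then show ?thesis
        using mid_deviation[OF lo[OF i(1)] hi[OF i(1)] diff[of i] _ _ r] lk[OF i(1)] l20
        unfolding mid_def by simp
    qed
    have volupd: "(\<Prod>i'<d. (hi(i := b)) i' - (lo(i := a)) i') = (b - a) * (\<Prod>i'\<in>{..<d}-{i}. hi i' - lo i')" for a b
      by (rule prod_fun_upd_split[where f = "\<lambda>_ b a. b - a", OF i(1)])
    have vol': "(hi i - lo i) * (\<Prod>i'\<in>{..<d}-{i}. hi i' - lo i') = N0 + N1"
      using volupd[of "hi i" "lo i"] vol NN by simp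
    have vol0: "(\<Prod>i'<d. (hi(i := mid)) i' - lo i') = N0"
    proof -
      have "(\<Prod>i'<d. (hi(i := mid)) i' - lo i') = (mid - lo i) * (\<Prod>i'\<in>{..<d}-{i}. hi i' - lo i')"
        using volupd[of mid "lo i"] by simp
      also have "\<dots> = r * (N0 + N1)" unfolding vol'[symmetric] mid_def by (simp add: algebra_simps)
      also have "\<dots> = N0" unfolding r_def using Npos by simp
      finally show ?thesis .
    qed
    have vol1: "(\<Prod>i'<d. hi i' - (lo(i := mid)) i') = N1"
    proof -
      have "(\<Prod>i'<d. hi i' - (lo(i := mid)) i') = (hi i - mid) * (\<Prod>i'\<in>{..<d}-{i}. hi i' - lo i')"
        using volupd[of "hi i" mid] by simp
      also have "\<dots> = (1 - r) * (N0 + N1)" unfolding vol'[symmetric] mid_def by (simp add: algebra_simps)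
      also have "\<dots> = N1" unfolding r_def using Npos by (simp add: field_simps)
      finally show ?thesis .
    qed
    have dec: "(\<Sum>i'<d. K - ?\<kappa> i') < (\<Sum>i'<d. K - \<kappa> i')"
    proof (rule sum_strict_mono_ex1)
      show "\<exists>i'\<in>{..<d}. K - ?\<kappa> i' < K - \<kappa> i'" using i(1) iK by (intro bexI[of _ i]) auto
    qed auto
    have bal': "?\<kappa> i2 \<le> Suc (?\<kappa> i1)" if "i1 < d" "i2 < d" for i1 i2
      using bK[OF that(1)] bK[OF that(2)] by linarith
    have e0: "real n * real (2 * j i) / 2 ^ Suc (\<kappa> i) = real n * real (j i) / 2 ^ \<kappa> i"
      and e1: "real n * real (Suc (2 * j i + 1)) / 2 ^ Suc (\<kappa> i) = real n * real (Suc (j i)) / 2 ^ \<kappa> i"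
      by (simp_all add: field_simps)
    have IH0: "(\<Sum>g\<in>G. cube_overlap d lo (hi(i := mid)) g)
        \<le> real (card {x \<in> S \<inter> ?QL. \<exists>g\<in>G. near d n m R x g})"
      unfolding R_def
    proof (rule less.hyps[OF dec])
      fix i' assume i': "i' < d"
      show "?\<kappa> i' \<le> K" "?jL i' < 2 ^ ?\<kappa> i'" using bK[OF i'] by auto
      show "\<bar>lo i' - real n * real (?jL i') / 2 ^ ?\<kappa> i'\<bar> \<le> 10 * real (?\<kappa> i')"
        using lo[OF i'] e0 by (cases "i' = i") auto
      show "\<bar>(hi(i := mid)) i' - real n * real (Suc (?jL i')) / 2 ^ ?\<kappa> i'\<bar> \<le> 10 * real (?\<kappa> i')"
        using hi[OF i'] middev by (cases "i' = i") auto
    qed ((rule bal'; assumption), rule vol0[unfolded N0_def])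
    have IH1: "(\<Sum>g\<in>G. cube_overlap d (lo(i := mid)) hi g)
        \<le> real (card {x \<in> S \<inter> ?QR. \<exists>g\<in>G. near d n m R x g})"
      unfolding R_def
    proof (rule less.hyps[OF dec])
      fix i' assume i': "i' < d"
      show "?\<kappa> i' \<le> K" "?jR i' < 2 ^ ?\<kappa> i'" using bK[OF i'] by auto
      show "\<bar>(lo(i := mid)) i' - real n * real (?jR i') / 2 ^ ?\<kappa> i'\<bar> \<le> 10 * real (?\<kappa> i')"
        using lo[OF i'] middev by (cases "i' = i") auto
      show "\<bar>hi i' - real n * real (Suc (?jR i')) / 2 ^ ?\<kappa> i'\<bar> \<le> 10 * real (?\<kappa> i')"
        using hi[OF i'] e1 by (cases "i' = i") auto
    qed ((rule bal'; assumption), rule vol1[unfolded N1_def])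
    have "(\<Sum>g\<in>G. cube_overlap d lo hi g)
        = (\<Sum>g\<in>G. cube_overlap d lo (hi(i := mid)) g) + (\<Sum>g\<in>G. cube_overlap d (lo(i := mid)) hi g)"
      by (simp add: cube_overlap_split[of i d lo mid hi, OF i(1) mid] sum.distrib)
    also have "\<dots> \<le> real (card {x \<in> S \<inter> ?QL. \<exists>g\<in>G. near d n m R x g} + card {x \<in> S \<inter> ?QR. \<exists>g\<in>G. near d n m R x g})"
      using IH0 IH1 by simp
    also have "card {x \<in> S \<inter> ?QL. \<exists>g\<in>G. near d n m R x g} + card {x \<in> S \<inter> ?QR. \<exists>g\<in>G. near d n m R x g}
        = card ({x \<in> S \<inter> ?QL. \<exists>g\<in>G. near d n m R x g} \<union> {x \<in> S \<inter> ?QR. \<exists>g\<in>G. near d n m R x g})"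
      using fS spl(2) by (intro card_Un_disjoint[symmetric]) auto
    also have "{x \<in> S \<inter> ?QL. \<exists>g\<in>G. near d n m R x g} \<union> {x \<in> S \<inter> ?QR. \<exists>g\<in>G. near d n m R x g}
        = {x \<in> S \<inter> ?Q. \<exists>g\<in>G. near d n m R x g}"
      using spl(1) by auto
    finally show ?thesis unfolding R_def .
  qed
qed

text \<open>The recursion starts from the whole cubes, with exact corners and volume
  \<open>n ^ d = card S\<close>. It bounds the neighbourhoods of sets of grid points, so Hall's
  theorem gives an injection from the grid into \<open>S\<close>; as the sizes agree, it can be
  inverted.\<close>

lemma exists_near_bijection:
  assumes mn: "n \<le> m" "n > 0" and p: "p > 0"
    and l: "20 \<le> real n / 2 ^ K" "20 * real K \<le> real n / 2 ^ K"
    and reg: "regular_set d n m K p S" and S: "S \<subseteq> grid d m" "card S = n ^ d"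
  shows "\<exists>f. f ` S = grid d n \<and> (\<forall>x\<in>S. near d n m (real n / 2 ^ K + 10 * real K + 1) x (f x))"
proof -
  define R where "R = real n / 2 ^ K + 10 * real K + 1"
  have fS: "finite S" using S(1) finite_grid finite_subset by blast
  have top: "dbox d m (\<lambda>_. 0) (\<lambda>_. 0) = grid d m"
    unfolding dbox_def grid_eq_zbox cell_0_0 ..
  have SQ: "S \<inter> dbox d m (\<lambda>_. 0) (\<lambda>_. 0) = S" using S(1) unfolding top by blast
  have "card G \<le> card (\<Union>g\<in>G. {x\<in>S. near d n m R x g})" if G: "G \<subseteq> grid d n" for G
  proof -
    have "cube_overlap d (\<lambda>_. 0) (\<lambda>_. real n) g = 1" if "g \<in> G" for g
    proof -
      have g: "1 \<le> g i \<and> g i \<le> int n" if "i < d" for i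
        using \<open>g \<in> G\<close> G that by (auto simp: grid_def)
      have "overlap 0 (real n) (g i) = 1" if "i < d" for i
      proof -
        have "real_of_int (g i) \<ge> 1" "real_of_int (g i) \<le> real n" using g[OF that] by linarith+
        then show ?thesis unfolding overlap_def by simp
      qed
      then show ?thesis unfolding cube_overlap_def by simp
    qed
    then have "real (card G) = (\<Sum>g\<in>G. cube_overlap d (\<lambda>_. 0) (\<lambda>_. real n) g)" by simp
    also have "\<dots> \<le> real (card {x \<in> S \<inter> dbox d m (\<lambda>_. 0) (\<lambda>_. 0). \<exists>g\<in>G. near d n m R x g})"
      unfolding R_def
      by (rule hall_condition_dbox[OF mn p l reg fS G]) (use S(2) SQ in auto)
    also have "{x \<in> S \<inter> dbox d m (\<lambda>_. 0) (\<lambda>_. 0). \<exists>g\<in>G. near d n m R x g} = (\<Union>g\<in>G. {x\<in>S. near d n m R x g})"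
      unfolding SQ by blast
    finally show ?thesis by simp
  qed
  then obtain h where h: "inj_on h (grid d n)" "\<forall>g\<in>grid d n. h g \<in> {x\<in>S. near d n m R x g}"
    using hall_marriage[of "grid d n" "\<lambda>g. {x\<in>S. near d n m R x g}"] finite_grid fS by auto
  have "h ` grid d n \<subseteq> S" using h(2) by auto
  moreover have "card (h ` grid d n) = card S"
    using card_image[OF h(1)] S(2) by (simp add: card_grid)
  ultimately have im: "h ` grid d n = S" using fS card_subset_eq by blast
  show ?thesis
  proof (intro exI conjI ballI)
    show "inv_into (grid d n) h ` S = grid d n"
      using h(1) im inv_into_image_cancel by blast
    fix x assume "x \<in> S"
    then obtain g where "g \<in> grid d n" "x = h g" using im by blast
    then show "near d n m (real n / 2 ^ K + 10 * real K + 1) x (inv_into (grid d n) h x)"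
      using h unfolding R_def by simp
  qed
qed

section \<open>Bounding the Lipschitz constant\<close>

lemma abs_coord_le_edist:
  assumes "i < d"
  shows "\<bar>real_of_int (x i - y i)\<bar> \<le> edist d x y"
proof -
  have "(real_of_int (x i - y i))\<^sup>2 \<le> (\<Sum>i<d. (real_of_int (x i - y i))\<^sup>2)"
    using assms by (intro member_le_sum) auto
  then have "sqrt ((real_of_int (x i - y i))\<^sup>2) \<le> edist d x y"
    unfolding edist_def by (rule real_sqrt_le_mono)
  then show ?thesis by simp
qed

lemma edist_nonneg: "edist d x y \<ge> 0"
  by (auto simp: edist_def intro!: sum_nonneg)

lemma edist_ge_1:
  assumes "x \<in> zvecs d" "y \<in> zvecs d" "x \<noteq> y"
  shows "1 \<le> edist d x y"
proof -
  obtain i where i: "x i \<noteq> y i" using assms(3) by auto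
  have "i < d"
  proof (rule ccontr)
    assume "\<not> i < d"
    then have "x i = 0" "y i = 0" using assms(1,2) by (auto simp: zvecs_def)
    then show False using i by simp
  qed
  moreover have "1 \<le> \<bar>real_of_int (x i - y i)\<bar>" using i by linarith
  ultimately show ?thesis using abs_coord_le_edist[of i d x y] by linarith
qed

text \<open>An infimum over the empty set would be unspecified, so a Lipschitz constant has to be
  exhibited: the sum of all image distances works, since distinct lattice points are at least 1
  apart. The result bounds the set in \<open>Fn\<close> from below.\<close>

lemma lip_nonneg:
  assumes "finite S" "S \<subseteq> zvecs d"
  shows "0 \<le> lip d S f"
  unfolding lip_def
proof (rule cInf_greatest)
  let ?L = "\<Sum>x\<in>S. \<Sum>y\<in>S. edist d (f x) (f y)"
  have "edist d (f x) (f y) \<le> ?L * edist d x y" if xy: "x \<in> S" "y \<in> S" for x y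
  proof (cases "x = y")
    case False
    have "edist d (f x) (f y) \<le> (\<Sum>y\<in>S. edist d (f x) (f y))"
      using assms(1) xy by (intro member_le_sum) (auto intro: edist_nonneg)
    also have "\<dots> \<le> ?L"
      using assms(1) xy by (intro member_le_sum[where f = "\<lambda>x. \<Sum>y\<in>S. edist d (f x) (f y)"])
        (auto intro!: edist_nonneg sum_nonneg)
    also have "?L = ?L * 1" by simp
    also have "\<dots> \<le> ?L * edist d x y"
      by (intro mult_left_mono edist_ge_1 sum_nonneg edist_nonneg) (use xy assms(2) False in auto)
    finally show ?thesis .
  qed (simp add: edist_def)
  moreover have "?L \<ge> 0" by (intro sum_nonneg edist_nonneg)
  ultimately show "{L. L \<ge> 0 \<and> (\<forall>x\<in>S. \<forall>y\<in>S. edist d (f x) (f y) \<le> L * edist d x y)} \<noteq> {}"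
    by blast
qed auto

text \<open>In each coordinate \<open>f x\<close> and \<open>f y\<close> differ by at most
  \<open>2 * R\<close> more than the scaled points; \<open>n \<le> m\<close> makes the scaling
  non-expansive, and a distance of at least 1 absorbs \<open>2 * R\<close>. The factor
  \<open>sqrt d\<close> passes from coordinates to the Euclidean norm.\<close>

lemma Fn_le_of_near:
  assumes "n \<le> m" "n > 0" "R \<ge> 0"
    and f: "f ` S = grid d n" "\<And>x. x \<in> S \<Longrightarrow> near d n m R x (f x)" and S: "finite S" "S \<subseteq> zvecs d"
  shows "Fn d n S \<le> sqrt (real d) * (2 * R + 1)"
proof -
  define C where "C = sqrt (real d) * (2 * R + 1)"
  have C0: "C \<ge> 0" unfolding C_def using assms(3) by simp
  have Lip: "edist d (f x) (f y) \<le> C * edist d x y" if xy: "x \<in> S" "y \<in> S" for x y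
  proof (cases "x = y")
    case False
    note coord = abs_coord_le_edist[of _ d x y]
    have one: "1 \<le> edist d x y" using edist_ge_1[OF _ _ False] S(2) xy by auto
    have fc: "\<bar>real_of_int (f x i - f y i)\<bar> \<le> (2 * R + 1) * edist d x y" if i: "i < d" for i
    proof -
      have a: "\<bar>of_int (f x i) - real n / real m * of_int (x i)\<bar> \<le> R" "\<bar>of_int (f y i) - real n / real m * of_int (y i)\<bar> \<le> R"
        using f(2)[OF xy(1)] f(2)[OF xy(2)] i unfolding near_def by auto
      have tri: "\<bar>u - v\<bar> \<le> 2 * R * 1 + e"
        if "\<bar>u - u'\<bar> \<le> R" "\<bar>v - v'\<bar> \<le> R" "\<bar>u' - v'\<bar> \<le> 1 * e" for u v u' v' e :: real
        using that by linarith
      have "\<bar>real n / real m * of_int (x i) - real n / real m * of_int (y i)\<bar> = real n / real m * \<bar>real_of_int (x i - y i)\<bar>"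
      proof -
        have "real n / real m * of_int (x i) - real n / real m * of_int (y i) = real n / real m * real_of_int (x i - y i)"
          by (simp only: right_diff_distrib of_int_diff)
        then show ?thesis by (simp only: abs_mult) simp
      qed
      also have "\<dots> \<le> 1 * edist d x y"
        using assms(1,2) coord[OF i] by (intro mult_mono) auto
      finally have "\<bar>real_of_int (f x i - f y i)\<bar> \<le> 2 * R * 1 + edist d x y"
        unfolding of_int_diff using tri[OF a] by blast
      also have "\<dots> \<le> 2 * R * edist d x y + edist d x y"
        using one assms(3) by (intro add_mono mult_left_mono) auto
      finally show ?thesis by (simp add: algebra_simps)
    qed
    have e0: "edist d x y \<ge> 0" using one by simp
    have "(\<Sum>i<d. (real_of_int (f x i - f y i))\<^sup>2) \<le> (\<Sum>i<d. ((2 * R + 1) * edist d x y)\<^sup>2)"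
      using fc by (intro sum_mono) (metis abs_ge_zero power2_abs power_mono lessThan_iff)
    then have "edist d (f x) (f y) \<le> sqrt (real d * ((2 * R + 1) * edist d x y)\<^sup>2)"
      unfolding edist_def[of d "f x"] by simp
    also have "\<dots> = C * edist d x y"
      unfolding real_sqrt_mult C_def using e0 assms(3) by simp
    finally show ?thesis .
  qed (simp add: edist_def)
  have bd: "bdd_below {L. L \<ge> 0 \<and> (\<forall>x\<in>S. \<forall>y\<in>S. edist d (f x) (f y) \<le> L * edist d x y)}" for f
    by (intro bdd_belowI[of _ 0]) auto
  have "lip d S f \<le> C"
    unfolding lip_def by (rule cInf_lower[OF _ bd]) (use Lip C0 in auto)
  moreover have "Fn d n S \<le> lip d S f"
    unfolding Fn_def
  proof (rule cInf_lower)
    show "bdd_below {lip d S f |f. f ` S = grid d n}"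
      by (rule bdd_belowI[of _ 0]) (use lip_nonneg[OF S] in auto)
  qed (use f(1) in blast)
  ultimately show ?thesis unfolding C_def by linarith
qed

section \<open>Irregular subsets are rare\<close>

lemma cell_subset:
  assumes "j < 2 ^ k"
  shows "cell m k j \<subseteq> {1..int m}"
proof
  fix a assume "a \<in> cell m k j"
  then have a: "\<lfloor>real j * real m / 2 ^ k\<rfloor> < a" "a \<le> \<lfloor>real (Suc j) * real m / 2 ^ k\<rfloor>"
    by (auto simp: cell_def)
  have 0: "0 \<le> \<lfloor>real j * real m / 2 ^ k\<rfloor>" by simp
  have "real (Suc j) * real m / 2 ^ k \<le> real m"
  proof -
    have "real (Suc j) \<le> 2 ^ k" using assms by (metis Suc_leI of_nat_le_iff of_nat_numeral of_nat_power)
    then have "real (Suc j) * real m \<le> 2 ^ k * real m" by (intro mult_right_mono) auto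
    then show ?thesis by (simp add: divide_le_eq mult.commute)
  qed
  then have "\<lfloor>real (Suc j) * real m / 2 ^ k\<rfloor> \<le> int m" by linarith
  then have "a \<le> int m" using a(2) by linarith
  moreover have "1 \<le> a" using a(1) 0 by linarith
  ultimately show "a \<in> {1..int m}" by simp
qed

lemma dbox_subset_grid:
  assumes "\<And>i. i < d \<Longrightarrow> j i < 2 ^ \<kappa> i"
  shows "dbox d m \<kappa> j \<subseteq> grid d m"
  using cell_subset[OF assms] unfolding dbox_def grid_eq_zbox zbox_def by blast

text \<open>A deviation falls in one of the two tails, hence the factor 2.\<close>

lemma irregular_dbox_card_le:
  fixes \<delta> :: real
  assumes "n \<le> m" "n > 0" "Q \<subseteq> grid d m" "0 \<le> \<delta>" "\<delta> \<le> 1"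
  defines "F \<equiv> {S. S \<subseteq> grid d m \<and> card S = n ^ d}"
    and "\<mu> \<equiv> (real n / real m) ^ d * real (card Q)"
  shows "real (card {S\<in>F. \<bar>real (card (S \<inter> Q)) - \<mu>\<bar> > \<mu> * \<delta>}) \<le> 2 * real (card F) * exp (- \<mu> * \<delta>\<^sup>2 / 4)"
proof -
  have le: "n ^ d \<le> card (grid d m)" unfolding card_grid using assms(1) by (rule power_mono) simp
  have ne: "grid d m \<noteq> {}" using le assms(2) by (metis card.empty not_less zero_less_power)
  have mu: "\<mu> = real (n ^ d) / real (card (grid d m)) * real (card Q)"
    unfolding \<mu>_def card_grid by (simp add: power_divide)
  have fF: "finite F" unfolding F_def using finite_grid by simp
  let ?A = "{S\<in>F. real (card (S \<inter> Q)) \<ge> (1 + \<delta>) * \<mu>}" and ?B = "{S\<in>F. real (card (S \<inter> Q)) \<le> (1 - \<delta>) * \<mu>}"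
  have "card {S\<in>F. \<bar>real (card (S \<inter> Q)) - \<mu>\<bar> > \<mu> * \<delta>} \<le> card (?A \<union> ?B)"
    using fF by (intro card_mono) (auto simp: algebra_simps abs_if split: if_splits)
  also have "\<dots> \<le> card ?A + card ?B" by (rule card_Un_le)
  finally have "real (card {S\<in>F. \<bar>real (card (S \<inter> Q)) - \<mu>\<bar> > \<mu> * \<delta>}) \<le> real (card ?A) + real (card ?B)"
    by (simp flip: of_nat_add)
  then show ?thesis
    using upper_tail_uniform_subset[OF finite_grid le assms(3) ne assms(4,5)]
      lower_tail_uniform_subset[OF finite_grid le assms(3) ne assms(4,5)]
    unfolding mu F_def by linarith
qed

text \<open>Rounding costs a side at most 1, hence at most half of it when
  \<open>m / 2 ^ \<kappa> i \<ge> 2\<close>; since levels reach \<open>k + 1\<close>, the exponent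
  is \<open>k + 2\<close>.\<close>

lemma card_dbox_ge:
  assumes "n \<le> m" "n > 0" and l: "20 \<le> real n / 2 ^ K"
    and k: "\<And>i. i < d \<Longrightarrow> \<kappa> i \<le> Suc k \<and> \<kappa> i \<le> K"
  shows "(real m / 2 ^ (k + 2)) ^ d \<le> real (card (dbox d m \<kappa> j))"
proof -
  have "real m / 2 ^ (k + 2) \<le> real (card (cell m (\<kappa> i) (j i)))" if i: "i < d" for i
  proof -
    have "2 \<le> real n / 2 ^ K" using l by simp
    also have "\<dots> \<le> real n / 2 ^ \<kappa> i" using k[OF i] by (intro divide_left_mono power_increasing) auto
    also have "\<dots> \<le> real m / 2 ^ \<kappa> i" using assms(1) by (intro divide_right_mono) auto
    finally have "2 \<le> real m / 2 ^ \<kappa> i" .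
    moreover have "real m / 2 ^ (k + 2) \<le> real m / 2 ^ (Suc (\<kappa> i))"
      using k[OF i] by (intro divide_left_mono power_increasing) auto
    moreover have "real m / 2 ^ (Suc (\<kappa> i)) = real m / 2 ^ \<kappa> i / 2" by simp
    moreover have "y \<le> c" if "2 \<le> x" "y \<le> z" "z = x / 2" "\<bar>c - x\<bar> \<le> 1" for x y z c :: real
      using that by linarith
    ultimately show ?thesis using card_cell[of m "\<kappa> i" "j i"] by blast
  qed
  then have "(\<Prod>i<d. real m / 2 ^ (k + 2)) \<le> (\<Prod>i<d. real (card (cell m (\<kappa> i) (j i))))"
    by (intro prod_mono) auto
  then show ?thesis unfolding card_dbox by simp
qed

text \<open>Union bound over levels and boxes. At target side \<open>l\<close>,
  \<open>\<mu> \<ge> (l/4)^d\<close> and \<open>\<delta> = 1/l\<close> give an exponent of at least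
  \<open>l^(d-2) / (4 * 4^d)\<close>; here \<open>l^(d-2) \<ge> l^2 \<ge> 400 * L^2\<close>, by
  \<open>d \<ge> 4\<close> and \<open>l \<ge> 20 * L\<close>.\<close>

lemma irregular_sets_card_le:
  assumes d: "d \<ge> 4" and mn: "n \<le> m" "n > 0"
    and l: "20 \<le> real n / 2 ^ K" "20 * L \<le> real n / 2 ^ K" "L \<ge> 0"
  defines "F \<equiv> {S. S \<subseteq> grid d m \<and> card S = n ^ d}"
  shows "real (card {S\<in>F. \<not> regular_set d n m K ((real n / real m) ^ d) S})
      \<le> real n ^ (2 * d + 1) * (2 * real (card F) * exp (- (100 * L\<^sup>2 / 4 ^ d)))"
proof -
  define p where "p = (real n / real m) ^ d"
  define ok where "ok = (\<lambda>k (\<kappa> :: nat \<Rightarrow> nat) (j :: nat \<Rightarrow> nat). \<forall>i<d. k \<le> \<kappa> i \<and> \<kappa> i \<le> Suc k \<and> \<kappa> i \<le> K \<and> j i < 2 ^ \<kappa> i)"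
  define dev where "dev = (\<lambda>k \<kappa> j S. \<bar>real (card (S \<inter> dbox d m \<kappa> j)) - p * real (card (dbox d m \<kappa> j))\<bar>
       > p * real (card (dbox d m \<kappa> j)) / (real n / 2 ^ k))"
  \<comment> \<open>Levels and indices are restricted to coordinates below \<open>d\<close>, which
    makes the index set finite and leaves the boxes unchanged.\<close>
  define I where "I = {..K} \<times> (PiE {..<d} (\<lambda>_. {..K}) \<times> PiE {..<d} (\<lambda>_. {..<2 ^ K :: nat}))"
  define T where "T = (\<lambda>(k, \<kappa>, j). {S\<in>F. ok k \<kappa> j \<and> dev k \<kappa> j S})"
  define E where "E = 2 * real (card F) * exp (- (100 * L\<^sup>2 / 4 ^ d))"
  have E0: "E \<ge> 0" unfolding E_def by simp
  have fF: "finite F" unfolding F_def using finite_grid by simp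
  have fI: "finite I" unfolding I_def by (intro finite_cartesian_product finite_PiE) auto
  have Tle: "real (card (T t)) \<le> E" if "t \<in> I" for t
  proof -
    obtain k \<kappa> j where t: "t = (k, \<kappa>, j)" by (metis prod_cases3)
    show ?thesis
    proof (cases "ok k \<kappa> j")
      case False
      then show ?thesis using E0 by (simp add: T_def t)
    next
      case True
      let ?Q = "dbox d m \<kappa> j" and ?l = "real n / 2 ^ k"
      \<comment> \<open>Coordinate 0 exists, and its level bounds \<open>k\<close> by
        \<open>K\<close>.\<close>
      have "k \<le> \<kappa> 0 \<and> \<kappa> 0 \<le> K" using True d unfolding ok_def by simp
      then have k: "k \<le> K" by simp
      have lK: "real n / 2 ^ K \<le> ?l" using k by (intro divide_left_mono power_increasing) auto
      have l20: "20 \<le> ?l" "20 * L \<le> ?l" using lK l by linarith+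
      have l1: "1 \<le> ?l" using l20(1) by linarith
      define \<delta> where "\<delta> = 1 / ?l"
      have \<delta>: "0 \<le> \<delta>" "\<delta> \<le> 1"
        unfolding \<delta>_def using l20(1) by (simp, intro divide_le_eq_1_pos[THEN iffD2]) linarith+
      have p0: "p \<ge> 0" unfolding p_def by simp
      have Q: "?Q \<subseteq> grid d m" using True unfolding ok_def by (intro dbox_subset_grid) auto
      have "(real n / 2 ^ (k + 2)) ^ d = p * (real m / 2 ^ (k + 2)) ^ d"
        unfolding p_def using mn by (simp flip: power_mult_distrib)
      also have "\<dots> \<le> p * real (card ?Q)"
        using True unfolding ok_def by (intro mult_left_mono card_dbox_ge[OF mn l(1)] p0) auto
      finally have \<mu>: "(?l / 4) ^ d \<le> p * real (card ?Q)" by (simp add: power_add mult.commute)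
      have "100 * L\<^sup>2 / 4 ^ d \<le> ?l\<^sup>2 / 4 / 4 ^ d"
      proof -
        have "(20 * L)\<^sup>2 \<le> ?l\<^sup>2" using l20 l(3) by (intro power_mono) auto
        then have "100 * L\<^sup>2 \<le> ?l\<^sup>2 / 4" by (simp add: power_mult_distrib)
        then show ?thesis by (intro divide_right_mono) auto
      qed
      also have "\<dots> \<le> ?l ^ (d - 2) / 4 / 4 ^ d"
        using d l1 by (intro divide_right_mono power_increasing) auto
      also have "?l ^ (d - 2) = ?l ^ d * \<delta>\<^sup>2"
      proof -
        have "d - 2 + 2 = d" using d by simp
        then have "?l ^ d = ?l ^ (d - 2) * ?l\<^sup>2" by (metis power_add)
        then have "?l ^ d * \<delta>\<^sup>2 = ?l ^ (d - 2) * (?l * \<delta>)\<^sup>2" by (simp only: power_mult_distrib mult.assoc)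
        moreover have "?l * \<delta> = 1" unfolding \<delta>_def using mn(2) by simp
        ultimately show ?thesis by (simp only: power_one mult_1_right)
      qed
      also have "?l ^ d * \<delta>\<^sup>2 / 4 / 4 ^ d = (?l / 4) ^ d * \<delta>\<^sup>2 / 4" by (simp add: power_divide)
      also have "\<dots> \<le> (p * real (card ?Q)) * \<delta>\<^sup>2 / 4"
        by (intro divide_right_mono mult_right_mono \<mu>) auto
      finally have ex: "100 * L\<^sup>2 / 4 ^ d \<le> (p * real (card ?Q)) * \<delta>\<^sup>2 / 4" .
      have "T t = {S\<in>F. \<bar>real (card (S \<inter> ?Q)) - p * real (card ?Q)\<bar> > (p * real (card ?Q)) * \<delta>}"
        unfolding T_def t dev_def \<delta>_def using True by simp
      then have "real (card (T t)) \<le> 2 * real (card F) * exp (- (p * real (card ?Q)) * \<delta>\<^sup>2 / 4)"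
        using irregular_dbox_card_le[OF mn Q \<delta>] unfolding F_def p_def by simp
      also have "\<dots> \<le> E"
        unfolding E_def using ex by (intro mult_left_mono) auto
      finally show ?thesis .
    qed
  qed
  have "{S\<in>F. \<not> regular_set d n m K p S} \<subseteq> (\<Union>t\<in>I. T t)"
  proof
    fix S assume S: "S \<in> {S\<in>F. \<not> regular_set d n m K p S}"
    then have "\<exists>k \<kappa> j. ok k \<kappa> j \<and> dev k \<kappa> j S"
      unfolding regular_set_def ok_def dev_def
      by (simp only: mem_Collect_eq not_all not_imp not_le)
    then obtain k \<kappa> j where kj: "ok k \<kappa> j" "dev k \<kappa> j S" by blast
    let ?\<kappa> = "restrict \<kappa> {..<d}" and ?j = "restrict j {..<d}"
    have eq: "dbox d m ?\<kappa> ?j = dbox d m \<kappa> j" by (auto simp: dbox_def zbox_def)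
    have "ok k ?\<kappa> ?j" using kj(1) by (simp add: ok_def)
    moreover have "dev k ?\<kappa> ?j S" using kj(2) unfolding dev_def eq .
    moreover have "(k, ?\<kappa>, ?j) \<in> I"
    proof -
      have "k \<le> \<kappa> 0 \<and> \<kappa> 0 \<le> K" using kj(1) d unfolding ok_def by simp
      then have "k \<le> K" by simp
      moreover have "j i < 2 ^ K" if "i < d" for i
      proof -
        have "j i < 2 ^ \<kappa> i" "\<kappa> i \<le> K" using kj(1) that unfolding ok_def by auto
        moreover from this(2) have "(2::nat) ^ \<kappa> i \<le> 2 ^ K" by (intro power_increasing) auto
        ultimately show ?thesis by linarith
      qed
      ultimately show ?thesis using kj(1) unfolding I_def ok_def by auto
    qed
    moreover have "T (k, ?\<kappa>, ?j) = {S\<in>F. ok k ?\<kappa> ?j \<and> dev k ?\<kappa> ?j S}" by (simp add: T_def)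
    ultimately show "S \<in> (\<Union>t\<in>I. T t)" using S by blast
  qed
  moreover have "finite (\<Union>t\<in>I. T t)"
  proof (rule finite_UN_I[OF fI])
    show "finite (T t)" for t using fF by (cases t) (simp add: T_def)
  qed
  ultimately have "card {S\<in>F. \<not> regular_set d n m K p S} \<le> card (\<Union>t\<in>I. T t)"
    by (rule card_mono[rotated])
  also have "\<dots> \<le> (\<Sum>t\<in>I. card (T t))" by (rule card_UN_le[OF fI])
  finally have "real (card {S\<in>F. \<not> regular_set d n m K p S}) \<le> (\<Sum>t\<in>I. real (card (T t)))"
    unfolding of_nat_sum[symmetric] of_nat_le_iff .
  also have "\<dots> \<le> (\<Sum>t\<in>I. E)" by (intro sum_mono Tle)
  also have "\<dots> = real (card I) * E" by simp
  also have "\<dots> \<le> real n ^ (2 * d + 1) * E"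
  \<comment> \<open>There are \<open>(K+1) * (K+1)^d * (2^K)^d\<close> triples, and
    \<open>K + 1 \<le> 2^K \<le> n\<close>.\<close>
  proof (intro mult_right_mono E0)
    have "20 * 2 ^ K \<le> real n" using l(1) by (simp add: le_divide_eq)
    moreover have "(0::real) \<le> 2 ^ K" by simp
    ultimately have "real (2 ^ K) \<le> real n" unfolding of_nat_power of_nat_numeral by linarith
    then have "2 ^ K \<le> n" unfolding of_nat_le_iff .
    moreover have "Suc K \<le> 2 ^ K" by (simp add: Suc_leI)
    ultimately have "Suc K * (Suc K ^ d * (2 ^ K) ^ d) \<le> n * (n ^ d * n ^ d)"
      by (intro mult_mono power_mono) auto
    moreover have "card I = Suc K * (Suc K ^ d * (2 ^ K) ^ d)"
      unfolding I_def by (simp add: card_cartesian_product card_PiE)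
    moreover have "n * (n ^ d * n ^ d) = n ^ (2 * d + 1)" by (simp add: power_add mult_2)
    ultimately have "card I \<le> n ^ (2 * d + 1)" by simp
    then show "real (card I) \<le> real n ^ (2 * d + 1)" unfolding of_nat_power[symmetric] of_nat_le_iff .
  qed
  finally show ?thesis unfolding p_def E_def .
qed

section \<open>Tail bound for a single index\<close>

text \<open>The depth \<open>K\<close> puts the final target side between \<open>20 * L\<close> and
  \<open>40 * L\<close>, where \<open>L\<close> is the logarithm of \<open>n\<close>: long enough
  for irregular sets to be rare, short enough for a displacement of order \<open>L\<close>.\<close>

lemma prob_Fn_large_le:
  assumes d: "d \<ge> 4" and mn: "n \<le> m" "n \<ge> 2" and L: "20 * log 2 (real n) \<le> real n"
  shows "measure (measure_pmf (pmf_of_set {S. S \<subseteq> grid d m \<and> card S = n ^ d}))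
       {S. \<not> Fn d n S / log 2 (real n) \<le> sqrt (real d) * 103}
     \<le> 2 * real n ^ (2 * d + 1) * exp (- (100 / 4 ^ d) * (log 2 (real n))\<^sup>2)"
proof -
  define L where "L = log 2 (real n)"
  define F where "F = {S. S \<subseteq> grid d m \<and> card S = n ^ d}"
  define B where "B = {S. \<not> Fn d n S / log 2 (real n) \<le> sqrt (real d) * 103}"
  have L1: "L \<ge> 1" unfolding L_def using mn(2) by (simp add: le_log_iff)
  have n0: "n > 0" using mn by simp
  \<comment> \<open>\<open>2 ^ K\<close> will be the largest power of two up to
    \<open>n / (20 * L)\<close>; the assumed bound on the logarithm makes this quotient at least
    1.\<close>
  define k where "k = nat \<lfloor>real n / (20 * L)\<rfloor>"
  have q1: "real n / (20 * L) \<ge> 1" using L L1 unfolding L_def by (simp add: le_divide_eq)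
  have k: "k \<ge> 1" "real k \<le> real n / (20 * L)" "real n / (20 * L) < real (k + 1)"
    unfolding k_def using q1 by (linarith | simp add: le_nat_floor)+
  obtain K where K: "2 ^ K \<le> k" "k < 2 ^ (K + 1)" using ex_power_ivl1[of 2 k] k(1) by auto
  have "real (2 ^ K) \<le> real k" "real (k + 1) \<le> real (2 ^ (K + 1))" using K by linarith+
  then have "real (2 ^ K) \<le> real n / (20 * L)" "real n / (20 * L) < real (2 ^ (K + 1))" using k by linarith+
  then have K2: "2 ^ K \<le> real n / (20 * L)" "real n / (20 * L) < 2 * 2 ^ K" by simp_all
  have lK: "20 * L \<le> real n / 2 ^ K" "real n / 2 ^ K < 40 * L"
    using K2 L1 by (simp_all add: field_simps)
  have "real n / (20 * L) \<le> real n" using L1 by (simp add: divide_le_eq mult_le_cancel_left1)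
  then have "2 ^ K \<le> real n" using K2 by linarith
  then have KL: "real K \<le> L" unfolding L_def using n0 by (simp add: le_log_iff powr_realpow)
  have l20: "20 \<le> real n / 2 ^ K" "20 * real K \<le> real n / 2 ^ K" using lK L1 KL by linarith+
  have fF: "finite F" unfolding F_def using finite_grid by simp
  have Fne: "F \<noteq> {}"
  proof -
    have "n ^ d \<le> card (grid d m)" unfolding card_grid using mn(1) by (rule power_mono) simp
    then show ?thesis unfolding F_def by (metis (mono_tags, lifting) empty_iff mem_Collect_eq obtain_subset_with_card_n)
  qed
  define p where "p = (real n / real m) ^ d"
  have p: "p > 0" unfolding p_def using mn n0 by simp
  have sub: "F \<inter> B \<subseteq> {S\<in>F. \<not> regular_set d n m K p S}"
  proof
    fix S assume S: "S \<in> F \<inter> B"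
    have "\<not> regular_set d n m K p S"
    proof
      assume reg: "regular_set d n m K p S"
      have S': "S \<subseteq> grid d m" "card S = n ^ d" using S unfolding F_def by auto
      obtain f where f: "f ` S = grid d n" "\<forall>x\<in>S. near d n m (real n / 2 ^ K + 10 * real K + 1) x (f x)"
        using exists_near_bijection[OF mn(1) n0 p l20 reg S'] by blast
      have "Fn d n S \<le> sqrt (real d) * (2 * (real n / 2 ^ K + 10 * real K + 1) + 1)"
      proof (rule Fn_le_of_near[OF mn(1) n0 _ f(1)])
        show "finite S" using S'(1) finite_grid finite_subset by blast
        show "S \<subseteq> zvecs d" using S'(1) by (auto simp: grid_def)
      qed (use f(2) in auto)
      \<comment> \<open>\<open>2 * (40 * L + 10 * L + 1) + 1 \<le> 103 * L\<close>, as
        \<open>L \<ge> 1\<close> and \<open>K \<le> L\<close>.\<close>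
      also have "\<dots> \<le> sqrt (real d) * (103 * L)"
        using lK KL L1 by (intro mult_left_mono) auto
      finally have "Fn d n S / L \<le> sqrt (real d) * 103" using L1 by (simp add: divide_le_eq mult.assoc)
      then show False using S unfolding B_def L_def by simp
    qed
    then show "S \<in> {S\<in>F. \<not> regular_set d n m K p S}" using S by simp
  qed
  have "real (card (F \<inter> B)) \<le> real (card {S\<in>F. \<not> regular_set d n m K p S})"
    using fF sub by (intro of_nat_mono card_mono) auto
  also have "\<dots> \<le> real n ^ (2 * d + 1) * (2 * real (card F) * exp (- (100 * L\<^sup>2 / 4 ^ d)))"
    using irregular_sets_card_le[OF d mn(1) n0 l20(1) lK(1)] L1 unfolding F_def p_def by simp
  finally have "real (card (F \<inter> B)) / real (card F) \<le> 2 * real n ^ (2 * d + 1) * exp (- (100 * L\<^sup>2 / 4 ^ d))"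
    using Fne fF by (simp add: divide_le_eq card_gt_0_iff mult_ac)
  then show ?thesis
    using measure_pmf_of_set[OF Fne fF, of B] unfolding F_def B_def L_def by simp
qed

section \<open>Summation over all indices and conclusion\<close>

text \<open>Since \<open>ln n \<le> log 2 n\<close>, the exponential is at most \<open>n\<close> to
  the power \<open>- a * log 2 n\<close>. Eventually \<open>a * log 2 n \<ge> k + 2\<close>, so the
  terms drop below \<open>2 / n^2\<close>.\<close>

lemma summable_poly_exp_log_squared:
  fixes a :: real
  assumes "a > 0"
  shows "summable (\<lambda>n. 2 * real n ^ k * exp (- a * (log 2 (real n))\<^sup>2))"
proof (rule summable_comparison_test_ev)
  show "summable (\<lambda>n. 2 * inverse (real n ^ 2))"
    by (intro summable_mult inverse_power_summable) simp
  have "eventually (\<lambda>n. a * log 2 (real n) \<ge> real (k + 2)) sequentially"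
    using assms by real_asymp
  then show "\<forall>\<^sub>F n in sequentially. norm (2 * real n ^ k * exp (- a * (log 2 (real n))\<^sup>2)) \<le> 2 * inverse (real n ^ 2)"
    using eventually_ge_at_top[of 2]
  proof eventually_elim
    case (elim n)
    have ln: "0 \<le> ln (real n)" "ln (real n) \<le> log 2 (real n)"
    proof -
      have "ln 2 \<le> (1::real)" using ln_le_minus_one[of "2::real"] by simp
      then show "0 \<le> ln (real n)" "ln (real n) \<le> log 2 (real n)" using elim(2)
        by (auto simp: log_def le_divide_eq mult_left_le)
    qed
    have "real (k + 2) * ln (real n) \<le> (a * log 2 (real n)) * log 2 (real n)"
      using ln elim(1) by (intro mult_mono) auto
    then have "exp (- a * (log 2 (real n))\<^sup>2) \<le> exp (- (real (k + 2) * ln (real n)))"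
      by (simp add: power2_eq_square mult.assoc)
    also have "\<dots> = inverse (real n ^ (k + 2))"
      using elim(2) by (simp only: exp_minus exp_of_nat_mult) simp
    finally have "2 * real n ^ k * exp (- a * (log 2 (real n))\<^sup>2) \<le> 2 * real n ^ k * inverse (real n ^ (k + 2))"
      by (intro mult_left_mono) auto
    also have "\<dots> = 2 * inverse (real n ^ 2)"
      using elim(2) by (simp add: power_add power2_eq_square field_simps)
    finally show ?case by simp
  qed
qed

theorem theorem1:
  fixes d :: nat and c :: "nat \<Rightarrow> real"
  assumes "d \<ge> 4"
    and "\<forall>n. c n > 0"
    and "\<forall>n\<ge>2. c n \<ge> (1 + 2 ^ (d + 5) / log 2 (real n)) powr (1 / real d)"
  shows "measure (G_space d c)
           {S \<in> space (G_space d c).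
              limsup (\<lambda>n. ereal (Fn d n (S n) / log 2 (real n))) < \<infinity>} = 1"
proof -
  let ?M = "\<lambda>n. measure_pmf (pmf_of_set (factor_set d c n))"
  let ?G = "G_space d c"
  interpret P: product_prob_space ?M "{1..}"
    by (intro product_prob_spaceI prob_space_measure_pmf)
  have G: "?G = PiM {1..} ?M" unfolding G_space_def ..
  interpret G: prob_space ?G unfolding G by (rule P.prob_space_axioms)
  define C where "C = sqrt (real d) * 103"
  define B where "B = (\<lambda>n. {S. \<not> Fn d n S / log 2 (real n) \<le> C})"
  define b where "b = (\<lambda>n. 2 * real n ^ (2 * d + 1) * exp (- (100 / 4 ^ d) * (log 2 (real n))\<^sup>2))"
  have sb: "summable b" unfolding b_def by (rule summable_poly_exp_log_squared) simp
  \<comment> \<open>Gives \<open>n \<le> \<lfloor>c n * n\<rfloor>\<close>, so the map from the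
    source cube to the target cube shrinks or preserves lengths.\<close>
  have c1: "c n \<ge> 1" if "n \<ge> 2" for n
  proof -
    have "log 2 (real n) \<ge> 0" using that by simp
    then have "1 \<le> (1 + 2 ^ (d + 5) / log 2 (real n)) powr (1 / real d)"
      by (intro ge_one_powr_ge_zero) auto
    then show ?thesis using assms(3) that by fastforce
  qed
  have Bmeas: "{S \<in> space ?G. S n \<in> B n} \<in> sets ?G" if "n \<ge> 1" for n
    unfolding G using that by (intro sets_Collect_single') auto
  have prob: "measure ?G {S \<in> space ?G. S n \<in> B n} \<le> b n" if n: "n \<ge> 2" "20 * log 2 (real n) \<le> real n" for n
  proof -
    have "emeasure ?G {S \<in> space ?G. S n \<in> B n} = emeasure (?M n) (B n)"
      unfolding G using n by (intro P.emeasure_PiM_Collect_single) auto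
    then have e: "measure ?G {S \<in> space ?G. S n \<in> B n} = measure (?M n) (B n)"
      by (simp add: measure_def)
    have "real n \<le> c n * real n" using c1[OF n(1)] by (simp add: mult_le_cancel_right1)
    then have "n \<le> nat \<lfloor>c n * real n\<rfloor>" by (simp add: le_nat_floor)
    then show ?thesis
      unfolding e unfolding factor_set_def B_def C_def b_def using prob_Fn_large_le[OF assms(1) _ n] by simp
  qed
  have "eventually (\<lambda>n. 20 * log 2 (real n) \<le> real n) sequentially" by real_asymp
  then obtain N where N: "\<And>n. n \<ge> N \<Longrightarrow> 20 * log 2 (real n) \<le> real n"
    unfolding eventually_sequentially by blast
  \<comment> \<open>Emptied below the threshold where the tail bound starts; finitely many indices
    do not affect the limsup.\<close>
  define A where "A = (\<lambda>n. if n \<ge> max N 2 then {S \<in> space ?G. S n \<in> B n} else {})"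
  have "AE S in ?G. eventually (\<lambda>n. S \<in> space ?G - A n) sequentially"
  proof (rule borel_cantelli_AE1)
    show "A n \<in> sets ?G" for n unfolding A_def using Bmeas by auto
    show "emeasure ?G (A n) < \<infinity>" for n by (simp add: less_top[symmetric])
    show "summable (\<lambda>n. measure ?G (A n))"
    proof (rule summable_comparison_test[OF _ sb], intro exI allI impI)
      fix n assume "n \<ge> max N 2"
      then show "norm (measure ?G (A n)) \<le> b n" using prob N unfolding A_def by auto
    qed
  qed
  then have AE: "AE S in ?G. limsup (\<lambda>n. ereal (Fn d n (S n) / log 2 (real n))) < \<infinity>"
  proof eventually_elim
    case (elim S)
    then have "eventually (\<lambda>n. ereal (Fn d n (S n) / log 2 (real n)) \<le> ereal C) sequentially"
      using eventually_ge_at_top[of "max N 2"]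
      by eventually_elim (auto simp: A_def B_def)
    then have "limsup (\<lambda>n. ereal (Fn d n (S n) / log 2 (real n))) \<le> ereal C"
      by (rule Limsup_bounded)
    then show ?case by (rule le_less_trans) simp
  qed
  have meas: "(\<lambda>S. ereal (Fn d n (S n) / log 2 (real n))) \<in> borel_measurable ?G" for n
  \<comment> \<open>\<open>S 0\<close> is not a coordinate of the product; there the logarithm, and
    with it the quotient, takes the default value 0.\<close>
  proof (cases "n = 0")
    case True
    then show ?thesis by (simp add: log_def)
  next
    case False
    have "(\<lambda>S. S n) \<in> measurable ?G (?M n)"
      unfolding G using False by (intro measurable_component_singleton) auto
    moreover have "(\<lambda>x. ereal (Fn d n x / log 2 (real n))) \<in> borel_measurable (?M n)" by simp
    ultimately show ?thesis by (rule measurable_compose)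
  qed
  \<comment> \<open>Measurability turns the almost sure statement into a probability equal to
    1.\<close>
  have "{S \<in> space ?G. limsup (\<lambda>n. ereal (Fn d n (S n) / log 2 (real n))) < \<infinity>} \<in> sets ?G"
    using meas by measurable
  then show ?thesis using AE by (subst G.prob_Collect_eq_1)
qed

end
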